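(* Let $G=(V,E)$ be a directed planar graph in a disk of the type described in the context, and let $w:\mathcal R\to(\mathbb R\setminus 0)^{|E|}$ be its weight map. Universal Poisson brackets $\{\cdot,\cdot\}_{\mathcal R}$ such that the weight map $w$ is Poisson (that is, such that the pushforward of $\{\cdot,\cdot\}_{\mathcal R}$ under $w$ is a well-defined Poisson bracket on $(\mathbb R\setminus 0)^{|E|}$) form a $6$-parametric family defined by the relations $$\{x^i_v,x^j_v\}_v=\alpha_{ij}\,x^i_vx^j_v,\qquad i,j\in\{1,2,3\},\ i\ne j,$$ at each white vertex $v$ and $$\{x^i_v,x^j_v\}_v=\beta_{ij}\,x^i_vx^j_v,\qquad i,j\in\{1,2,3\},\ i\ne j,$$ at each black vertex $v$, where $\alpha_{ij}=-\alpha_{ji}$ and $\beta_{ij}=-\beta_{ji}$ are real constants (not depending on $v$).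
   Context: **Graph.** $G=(V,E)$ is a directed planar graph without loops and parallel edges drawn in a disk. Exactly $n$ vertices $b_1,\dots,b_n$ lie on the boundary circle, labelled counterclockwise; each is either a source (exactly one outgoing edge, no incoming edges) or a sink (exactly one incoming edge, no outgoing edges). All internal vertices have degree 3 and are either white (exactly one incoming edge) or black (exactly one outgoing edge). **Flags and the space $\mathcal R$.** A flag is a pair $(v,e)$ with $v$ an endpoint of the edge $e$. To each internal vertex $v$ assign a copy $(\mathbb R\setminus 0)^3_v$ of $(\mathbb R\setminus 0)^3$ with coordinates $x_v^1,x_v^2,x_v^3$, which label the three flags involving $v$: $x_v^1$ labels the flag of the unique incoming edge if $v$ is white and of the unique outgoing edge if $v$ is black, and $x_v^2,x_v^3$ label the other two. Each $(\mathbb R\setminus 0)^3_v$ carries a Poisson bracket $\{\cdot,\cdot\}_v$. To each boundary vertex $b_j$ assign a one-dimensional space $\mathbb R\setminus 0$ with coordinate $x_j^1$ labelling the unique flag involving $b_j$. $\mathcal R$ is the direct sum (product) of all these spaces, so $\dim\mathcal R=2|E|$, and $\{\cdot,\cdot\}_{\mathcal R}$ is the direct sum of the brackets $\{\cdot,\cdot\}_v$ (coordinates attached to different vertices commute). The bracket $\{\cdot,\cdot\}_{\mathcal R}$ is called universal if each $\{\cdot,\cdot\}_v$ depends only on the color of $v$. **Weight map.** For an edge $e$ with endpoints $v,u$, if the flags $(v,e)$ and $(u,e)$ are labelled by $x_v^i$ and $x_u^j$, put $w_e=x_v^ix_u^j$. The weight map $w:\mathcal R\to(\mathbb R\setminus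 0)^{|E|}$ sends a point to $(w_e)_{e\in E}$. *)

theory Defs
  imports "HOL-Analysis.Analysis" "Graph_Theory.Digraph"
begin

section \<open>Smooth functions and Poisson brackets on \<open>(\<real> \<setminus> 0)\<^sup>I\<close>\<close>

text \<open>
  The index sets that occur (the three flags at a vertex, all flags, all edges) vary with the
  graph, so a point of \<open>(\<real> \<setminus> 0)\<^sup>I\<close> is an extensional function on \<open>I\<close>; for finite \<open>I\<close> the
  product topology on functions induces the Euclidean one.
  Functions on \<open>(\<real> \<setminus> 0)\<^sup>I\<close> and brackets of such functions are extensional as well, so that HOL
  equality of functions and of brackets is equality of the mathematical objects.
\<close>

definition punctured :: "'i set \<Rightarrow> ('i \<Rightarrow> real) set" where
  "punctured I = (I \<rightarrow>\<^sub>E - {0})"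

definition partial_deriv :: "'i \<Rightarrow> (('i \<Rightarrow> real) \<Rightarrow> real) \<Rightarrow> ('i \<Rightarrow> real) \<Rightarrow> real" where
  "partial_deriv i f x = deriv (\<lambda>t. f (x(i := t))) (x i)"

primrec C_diff :: "nat \<Rightarrow> 'i set \<Rightarrow> (('i \<Rightarrow> real) \<Rightarrow> real) \<Rightarrow> bool" where
  "C_diff 0 I f \<longleftrightarrow> continuous_on (punctured I) f"
| "C_diff (Suc k) I f \<longleftrightarrow> continuous_on (punctured I) f \<and>
     (\<forall>i\<in>I. (\<forall>x\<in>punctured I. (\<lambda>t. f (x(i := t))) differentiable (at (x i))) \<and>
             C_diff k I (partial_deriv i f))"

definition smooth_functions :: "'i set \<Rightarrow> (('i \<Rightarrow> real) \<Rightarrow> real) set" where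
  "smooth_functions I = {f \<in> extensional (punctured I). \<forall>k. C_diff k I f}"

definition coord :: "'i set \<Rightarrow> 'i \<Rightarrow> ('i \<Rightarrow> real) \<Rightarrow> real" where
  "coord I i = (\<lambda>x\<in>punctured I. x i)"

type_synonym 'i bracket =
  "(('i \<Rightarrow> real) \<Rightarrow> real) \<Rightarrow> (('i \<Rightarrow> real) \<Rightarrow> real) \<Rightarrow> (('i \<Rightarrow> real) \<Rightarrow> real)"

definition poisson_bracket :: "'i set \<Rightarrow> 'i bracket \<Rightarrow> bool" where
  "poisson_bracket I B \<longleftrightarrow>
     B \<in> smooth_functions I \<rightarrow>\<^sub>E (smooth_functions I \<rightarrow>\<^sub>E smooth_functions I) \<and>
     (\<forall>f\<in>smooth_functions I. \<forall>g\<in>smooth_functions I.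
        B f g = (\<lambda>x\<in>punctured I. - B g f x)) \<and>
     (\<forall>f\<in>smooth_functions I. \<forall>g\<in>smooth_functions I. \<forall>h\<in>smooth_functions I. \<forall>a c.
        B (\<lambda>x\<in>punctured I. a * f x + c * g x) h
          = (\<lambda>x\<in>punctured I. a * B f h x + c * B g h x)) \<and>
     (\<forall>f\<in>smooth_functions I. \<forall>g\<in>smooth_functions I. \<forall>h\<in>smooth_functions I.
        B (\<lambda>x\<in>punctured I. f x * g x) h
          = (\<lambda>x\<in>punctured I. f x * B g h x + B f h x * g x)) \<and>
     (\<forall>f\<in>smooth_functions I. \<forall>g\<in>smooth_functions I. \<forall>h\<in>smooth_functions I.
        \<forall>x\<in>punctured I. B f (B g h) x + B g (B h f) x + B h (B f g) x = 0)"

section \<open>Directed planar graphs in a disk\<close>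

text \<open>\<open>b 1, \<dots>, b n\<close> are the boundary vertices.\<close>

definition boundary :: "nat \<Rightarrow> (nat \<Rightarrow> 'v) \<Rightarrow> 'v set" where
  "boundary n b = b ` {1..n}"

definition internal :: "('v, 'e) pre_digraph \<Rightarrow> nat \<Rightarrow> (nat \<Rightarrow> 'v) \<Rightarrow> 'v set" where
  "internal G n b = verts G - boundary n b"

definition white :: "('v, 'e) pre_digraph \<Rightarrow> nat \<Rightarrow> (nat \<Rightarrow> 'v) \<Rightarrow> 'v \<Rightarrow> bool" where
  "white G n b v \<longleftrightarrow> v \<in> internal G n b \<and> in_degree G v = 1"

definition black :: "('v, 'e) pre_digraph \<Rightarrow> nat \<Rightarrow> (nat \<Rightarrow> 'v) \<Rightarrow> 'v \<Rightarrow> bool" where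
  "black G n b v \<longleftrightarrow> v \<in> internal G n b \<and> out_degree G v = 1"

definition source :: "('v, 'e) pre_digraph \<Rightarrow> 'v \<Rightarrow> bool" where
  "source G v \<longleftrightarrow> out_degree G v = 1 \<and> in_degree G v = 0"

definition sink :: "('v, 'e) pre_digraph \<Rightarrow> 'v \<Rightarrow> bool" where
  "sink G v \<longleftrightarrow> in_degree G v = 1 \<and> out_degree G v = 0"

text \<open>
  A drawing in the closed disk with centre \<open>c\<close> and radius \<open>r\<close>: vertex \<open>v\<close> is placed at \<open>p v\<close>, edge
  \<open>e\<close> is the simple arc \<open>\<gamma> e\<close>, and different edges meet at most in common endpoints. The
  \<open>\<theta> j\<close> are the angles of the boundary vertices.
\<close>

definition drawn_in_disk :: "('v, 'e) pre_digraph \<Rightarrow> nat \<Rightarrow> (nat \<Rightarrow> 'v) \<Rightarrow> bool" where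
  "drawn_in_disk G n b \<longleftrightarrow>
     (\<exists>(c :: complex) (r :: real) (p :: 'v \<Rightarrow> complex) (\<gamma> :: 'e \<Rightarrow> real \<Rightarrow> complex)
        (\<theta> :: nat \<Rightarrow> real).
        r > 0 \<and>
        inj_on p (verts G) \<and>
        p ` verts G \<subseteq> cball c r \<and>
        (\<forall>v\<in>verts G. p v \<in> sphere c r \<longleftrightarrow> v \<in> boundary n b) \<and>
        (\<forall>j\<in>{1..n}. p (b j) = c + of_real r * cis (\<theta> j)) \<and>
        strict_mono_on {1..n} \<theta> \<and>
        (\<forall>i\<in>{1..n}. \<forall>j\<in>{1..n}. \<theta> j < \<theta> i + 2 * pi) \<and>
        (\<forall>e\<in>arcs G. arc (\<gamma> e) \<and> pathstart (\<gamma> e) = p (tail G e) \<and>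
           pathfinish (\<gamma> e) = p (head G e) \<and> path_image (\<gamma> e) \<subseteq> cball c r \<and>
           \<gamma> e ` {0<..<1} \<inter> p ` verts G = {}) \<and>
        (\<forall>e\<in>arcs G. \<forall>f\<in>arcs G. e \<noteq> f \<longrightarrow> \<gamma> e ` {0<..<1} \<inter> \<gamma> f ` {0<..<1} = {}))"

text \<open>
  The locale \<^locale>\<open>digraph\<close> (finite, no loops, no two edges with the same tail and head) still
  admits a pair of edges \<open>u \<rightarrow> v\<close> and \<open>v \<rightarrow> u\<close>. As edges of a drawn planar graph these are
  parallel, whence the injectivity condition.
\<close>

definition disk_network :: "('v, 'e) pre_digraph \<Rightarrow> nat \<Rightarrow> (nat \<Rightarrow> 'v) \<Rightarrow> bool" where
  "disk_network G n b \<longleftrightarrow>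
     digraph G \<and>
     inj_on (\<lambda>e. {tail G e, head G e}) (arcs G) \<and>
     inj_on b {1..n} \<and> boundary n b \<subseteq> verts G \<and>
     drawn_in_disk G n b \<and>
     (\<forall>v\<in>boundary n b. source G v \<or> sink G v) \<and>
     (\<forall>v\<in>internal G n b. in_degree G v + out_degree G v = 3 \<and>
        (white G n b v \<or> black G n b v))"

section \<open>Flags, the space \<open>\<R>\<close> and the weight map\<close>

text \<open>The flag \<open>(v, e)\<close> is labelled by the coordinate \<open>x\<^sub>v\<^sup>i\<close> with \<open>i = lab v e\<close>.\<close>

definition flag_labelling ::
  "('v, 'e) pre_digraph \<Rightarrow> nat \<Rightarrow> (nat \<Rightarrow> 'v) \<Rightarrow> ('v \<Rightarrow> 'e \<Rightarrow> nat) \<Rightarrow> bool" where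
  "flag_labelling G n b lab \<longleftrightarrow>
     (\<forall>v\<in>boundary n b. \<forall>e\<in>in_arcs G v \<union> out_arcs G v. lab v e = 1) \<and>
     (\<forall>v\<in>internal G n b. bij_betw (lab v) (in_arcs G v \<union> out_arcs G v) {1, 2, 3}) \<and>
     (\<forall>v. white G n b v \<longrightarrow> (\<forall>e\<in>in_arcs G v. lab v e = 1)) \<and>
     (\<forall>v. black G n b v \<longrightarrow> (\<forall>e\<in>out_arcs G v. lab v e = 1))"

text \<open>\<open>\<R>\<close> is \<open>punctured (flag_coords G n b)\<close>, the coordinate \<open>x\<^sub>v\<^sup>i\<close> of \<open>x\<close> being \<open>x (v, i)\<close>.\<close>

definition flag_coords :: "('v, 'e) pre_digraph \<Rightarrow> nat \<Rightarrow> (nat \<Rightarrow> 'v) \<Rightarrow> ('v \<times> nat) set" where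
  "flag_coords G n b = boundary n b \<times> {1} \<union> internal G n b \<times> {1, 2, 3}"

definition weight_map ::
  "('v, 'e) pre_digraph \<Rightarrow> ('v \<Rightarrow> 'e \<Rightarrow> nat) \<Rightarrow> ('v \<times> nat \<Rightarrow> real) \<Rightarrow> 'e \<Rightarrow> real" where
  "weight_map G lab x =
     (\<lambda>e\<in>arcs G. x (tail G e, lab (tail G e) e) * x (head G e, lab (head G e) e))"

section \<open>Brackets on \<open>\<R>\<close>\<close>

text \<open>One Poisson bracket \<open>br v\<close> on \<open>(\<real> \<setminus> 0)\<^sup>3\<^sub>v\<close> for each internal vertex \<open>v\<close>.\<close>

definition vertex_brackets ::
  "('v, 'e) pre_digraph \<Rightarrow> nat \<Rightarrow> (nat \<Rightarrow> 'v) \<Rightarrow> ('v \<Rightarrow> nat bracket) set" where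
  "vertex_brackets G n b = (internal G n b \<rightarrow>\<^sub>E {B. poisson_bracket {1, 2, 3} B})"

definition universal ::
  "('v, 'e) pre_digraph \<Rightarrow> nat \<Rightarrow> (nat \<Rightarrow> 'v) \<Rightarrow> ('v \<Rightarrow> nat bracket) \<Rightarrow> bool" where
  "universal G n b br \<longleftrightarrow>
     (\<forall>u v. white G n b u \<and> white G n b v \<longrightarrow> br u = br v) \<and>
     (\<forall>u v. black G n b u \<and> black G n b v \<longrightarrow> br u = br v)"

definition vertex_part :: "'v \<Rightarrow> ('v \<times> nat \<Rightarrow> real) \<Rightarrow> nat \<Rightarrow> real" where
  "vertex_part v x = (\<lambda>i\<in>{1, 2, 3}. x (v, i))"

definition replace_part ::
  "'v \<Rightarrow> ('v \<times> nat \<Rightarrow> real) \<Rightarrow> (nat \<Rightarrow> real) \<Rightarrow> 'v \<times> nat \<Rightarrow> real" where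
  "replace_part v x y = (\<lambda>(u, i). if u = v then y i else x (u, i))"

definition slice ::
  "'v \<Rightarrow> ('v \<times> nat \<Rightarrow> real) \<Rightarrow> (('v \<times> nat \<Rightarrow> real) \<Rightarrow> real) \<Rightarrow> (nat \<Rightarrow> real) \<Rightarrow> real" where
  "slice v x f = (\<lambda>y\<in>punctured {1, 2, 3}. f (replace_part v x y))"

text \<open>
  The direct sum of the vertex brackets: at the point \<open>x\<close>, the summand of \<open>v\<close> brackets the
  functions obtained from \<open>f\<close> and \<open>g\<close> by freezing all coordinates not attached to \<open>v\<close>. Boundary
  vertices contribute nothing, as a bracket on the one-dimensional \<open>\<real> \<setminus> 0\<close> is zero.
\<close>

definition sum_bracket ::
  "('v, 'e) pre_digraph \<Rightarrow> nat \<Rightarrow> (nat \<Rightarrow> 'v) \<Rightarrow> ('v \<Rightarrow> nat bracket) \<Rightarrow> ('v \<times> nat) bracket" where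
  "sum_bracket G n b br f g =
     (\<lambda>x\<in>punctured (flag_coords G n b).
        \<Sum>v\<in>internal G n b. br v (slice v x f) (slice v x g) (vertex_part v x))"

definition weight_map_poisson ::
  "('v, 'e) pre_digraph \<Rightarrow> nat \<Rightarrow> (nat \<Rightarrow> 'v) \<Rightarrow> ('v \<Rightarrow> 'e \<Rightarrow> nat) \<Rightarrow> ('v \<Rightarrow> nat bracket) \<Rightarrow> bool"
  where
  "weight_map_poisson G n b lab br \<longleftrightarrow>
     (\<exists>P. poisson_bracket (arcs G) P \<and>
        (\<forall>f\<in>smooth_functions (arcs G). \<forall>g\<in>smooth_functions (arcs G).
           sum_bracket G n b br
             (compose (punctured (flag_coords G n b)) f (weight_map G lab))
             (compose (punctured (flag_coords G n b)) g (weight_map G lab))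
           = compose (punctured (flag_coords G n b)) (P f g) (weight_map G lab)))"

definition antisymmetric_coeffs :: "(nat \<Rightarrow> nat \<Rightarrow> real) \<Rightarrow> bool" where
  "antisymmetric_coeffs \<alpha> \<longleftrightarrow>
     (\<forall>i\<in>{1, 2, 3}. \<forall>j\<in>{1, 2, 3}. i \<noteq> j \<longrightarrow> \<alpha> i j = - \<alpha> j i)"

definition quadratic_relations :: "(nat \<Rightarrow> nat \<Rightarrow> real) \<Rightarrow> nat bracket \<Rightarrow> bool" where
  "quadratic_relations \<alpha> B \<longleftrightarrow>
     (\<forall>i\<in>{1, 2, 3}. \<forall>j\<in>{1, 2, 3}. i \<noteq> j \<longrightarrow>
        B (coord {1, 2, 3} i) (coord {1, 2, 3} j)
          = (\<lambda>x\<in>punctured {1, 2, 3}. \<alpha> i j * x i * x j))"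

definition network_relations ::
  "('v, 'e) pre_digraph \<Rightarrow> nat \<Rightarrow> (nat \<Rightarrow> 'v) \<Rightarrow> (nat \<Rightarrow> nat \<Rightarrow> real) \<Rightarrow> (nat \<Rightarrow> nat \<Rightarrow> real) \<Rightarrow>
     ('v \<Rightarrow> nat bracket) \<Rightarrow> bool" where
  "network_relations G n b \<alpha> \<beta> br \<longleftrightarrow>
     (\<forall>v. white G n b v \<longrightarrow> quadratic_relations \<alpha> (br v)) \<and>
     (\<forall>v. black G n b v \<longrightarrow> quadratic_relations \<beta> (br v))"

text \<open>The antisymmetric coefficients with \<open>\<alpha>\<^sub>1\<^sub>2 = s\<close>, \<open>\<alpha>\<^sub>1\<^sub>3 = t\<close>, \<open>\<alpha>\<^sub>2\<^sub>3 = u\<close>.\<close>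

definition skew_coeffs :: "real \<Rightarrow> real \<Rightarrow> real \<Rightarrow> nat \<Rightarrow> nat \<Rightarrow> real" where
  "skew_coeffs s t u i j =
     (if (i, j) = (1, 2) then s else if (i, j) = (2, 1) then - s
      else if (i, j) = (1, 3) then t else if (i, j) = (3, 1) then - t
      else if (i, j) = (2, 3) then u else if (i, j) = (3, 2) then - u else 0)"

end

theory Submission
  imports Defs
begin

text \<open>
  A Poisson bracket on \<open>(\<real> \<setminus> 0)\<^sup>I\<close> is a biderivation, hence determined by its values on coordinates:
  Hadamard's lemma, applied one coordinate at a time, expands a point derivation in the partial
  derivatives. Conversely \<open>\<Sum> c\<^sub>i\<^sub>j x\<^sub>i x\<^sub>j \<partial>\<^sub>i f \<partial>\<^sub>j g\<close> with antisymmetric \<open>c\<close> is always Poisson, since the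
  fields \<open>x\<^sub>i \<partial>\<^sub>i\<close> commute.

  If the weight map is Poisson and \<open>e\<close>, \<open>e'\<close> are two edges at an internal vertex \<open>v\<close>, then \<open>v\<close> is their
  only common vertex, so \<open>{w\<^sub>e, w\<^sub>e\<^sub>'}\<close> is the bracket of the two flag coordinates at \<open>v\<close> times the
  opposite flag coordinates, and it depends on the weights only. Rescaling the coordinates at \<open>v\<close>
  and inversely the opposite ones fixes all weights, which forces \<open>{x\<^sup>i, x\<^sup>j} = \<alpha>\<^sub>i\<^sub>j x\<^sup>i x\<^sup>j\<close>.
  Conversely, such brackets push forward to a bracket of the same form in the edge weights, the
  coefficient of \<open>(e, e')\<close> being the sum of those at the common vertices of \<open>e\<close> and \<open>e'\<close>.
\<close>

section \<open>Differentiability on the punctured space\<close>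

lemma punctured_nonzero: "x \<in> punctured I \<Longrightarrow> i \<in> I \<Longrightarrow> x i \<noteq> 0"
  by (auto simp: punctured_def PiE_def Pi_def)

lemma punctured_upd: "x \<in> punctured I \<Longrightarrow> i \<in> I \<Longrightarrow> t \<noteq> 0 \<Longrightarrow> x(i := t) \<in> punctured I"
  by (auto simp: punctured_def PiE_def Pi_def extensional_def)

text \<open>Only the coordinate \<open>i\<close> moves and \<open>- {0}\<close> is open, so a
  punctured space is open along each coordinate line. Hence partial derivatives at its points see
  only values on it, although functions are total in HOL.\<close>

lemma eventually_punctured_upd:
  assumes "x \<in> punctured I" "i \<in> I"
  shows "\<forall>\<^sub>F t in nhds (x i). x(i := t) \<in> punctured I"
proof -
  have "\<forall>\<^sub>F t in nhds (x i). t \<in> - {0}"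
    using punctured_nonzero[OF assms] by (intro eventually_nhds_in_open) auto
  then show ?thesis
    by eventually_elim (use assms punctured_upd in auto)
qed

lemma partial_deriv_cong:
  assumes "\<And>y. y \<in> punctured I \<Longrightarrow> f y = g y" "x \<in> punctured I" "i \<in> I"
  shows "partial_deriv i f x = partial_deriv i g x"
  unfolding partial_deriv_def
  using eventually_punctured_upd[OF assms(2,3)]
  by (intro deriv_cong_ev) (auto elim!: eventually_mono simp: assms(1))

lemma has_partial_cong:
  assumes "\<And>y. y \<in> punctured I \<Longrightarrow> f y = g y" "x \<in> punctured I" "i \<in> I"
  shows "((\<lambda>t. f (x(i := t))) has_field_derivative d) (at (x i)) \<longleftrightarrow>
         ((\<lambda>t. g (x(i := t))) has_field_derivative d) (at (x i))"
  using eventually_punctured_upd[OF assms(2,3)]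
  by (intro DERIV_cong_ev) (auto elim!: eventually_mono simp: assms(1))

lemma partial_deriv_eq:
  "((\<lambda>t. f (x(i := t))) has_field_derivative d) (at (x i)) \<Longrightarrow> partial_deriv i f x = d"
  unfolding partial_deriv_def by (rule DERIV_imp_deriv)

section \<open>Closure properties of k times continuously differentiable functions\<close>

lemma C_diff_imp_continuous_on: "C_diff k I f \<Longrightarrow> continuous_on (punctured I) f"
  by (cases k) auto

lemma C_diff_SucD: "C_diff (Suc k) I f \<Longrightarrow> C_diff k I f"
proof (induction k arbitrary: f)
  case (Suc k)
  then show ?case by (metis C_diff.simps(2))
qed simp

lemma C_diff_has_partial:
  assumes "C_diff (Suc k) I f" "x \<in> punctured I" "i \<in> I"
  shows "((\<lambda>t. f (x(i := t))) has_field_derivative partial_deriv i f x) (at (x i))"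
  using assms by (auto simp: partial_deriv_def DERIV_deriv_iff_real_differentiable)

lemma C_diff_cong:
  assumes "\<And>y. y \<in> punctured I \<Longrightarrow> f y = g y"
  shows "C_diff k I f \<longleftrightarrow> C_diff k I g"
  using assms
proof (induction k arbitrary: f g)
  case 0
  then show ?case by (simp cong: continuous_on_cong)
next
  case (Suc k)
  have "C_diff k I (partial_deriv i f) \<longleftrightarrow> C_diff k I (partial_deriv i g)" if "i \<in> I" for i
    using that Suc.prems by (intro Suc.IH partial_deriv_cong) auto
  moreover have "(\<lambda>t. f (x(i := t))) differentiable (at (x i)) \<longleftrightarrow>
      (\<lambda>t. g (x(i := t))) differentiable (at (x i))" if "i \<in> I" "x \<in> punctured I" for i x
    using has_partial_cong[of I f g x i, OF Suc.prems that(2,1)]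
    by (simp add: real_differentiable_def)
  moreover have "continuous_on (punctured I) f \<longleftrightarrow> continuous_on (punctured I) g"
    using Suc.prems by (simp cong: continuous_on_cong)
  ultimately show ?case by simp
qed

text \<open>The partial derivatives may be given by any formula \<open>D i\<close> that is valid on
  the punctured space. The induction steps of the closure properties below use this form.\<close>

lemma C_diff_SucI:
  assumes "continuous_on (punctured I) f"
    and D: "\<And>i x. i \<in> I \<Longrightarrow> x \<in> punctured I \<Longrightarrow>
      ((\<lambda>t. f (x(i := t))) has_field_derivative D i x) (at (x i))"
    and "\<And>i. i \<in> I \<Longrightarrow> C_diff k I (D i)"
  shows "C_diff (Suc k) I f"
proof -
  have "C_diff k I (partial_deriv i f)" if "i \<in> I" for i
    using assms(3)[OF that]
    by (subst C_diff_cong[where g = "D i"]) (auto intro!: partial_deriv_eq D that)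
  then show ?thesis
    using assms(1) D by (auto simp: real_differentiable_def)
qed

lemma C_diff_const: "C_diff k I (\<lambda>x. c)"
proof (induction k arbitrary: c)
  case (Suc k)
  show ?case by (rule C_diff_SucI[where D = "\<lambda>i x. 0"]) (auto intro: Suc continuous_intros)
qed (auto intro: continuous_intros)

lemma continuous_on_component: "continuous_on A (\<lambda>x. (x i :: real))"
  using continuous_on_subset[OF continuous_on_product_coordinates subset_UNIV] .

lemma C_diff_component: "C_diff k I (\<lambda>x. x i)"
proof (cases k)
  case (Suc k')
  show ?thesis unfolding Suc
  proof (rule C_diff_SucI[where D = "\<lambda>j x. if j = i then 1 else 0"])
    show "((\<lambda>t. (x(j := t)) i) has_field_derivative (if j = i then 1 else 0)) (at (x j))"
      for j and x :: "'a \<Rightarrow> real"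
      by (cases "j = i") (auto intro!: derivative_eq_intros)
  qed (auto intro: C_diff_const continuous_on_component)
qed (auto intro: continuous_on_component)

lemma C_diff_sum:
  assumes "\<And>s. s \<in> S \<Longrightarrow> C_diff k I (f s)"
  shows "C_diff k I (\<lambda>x. \<Sum>s\<in>S. f s x)"
  using assms
proof (induction k arbitrary: f)
  case (Suc k)
  show ?case
  proof (rule C_diff_SucI[where D = "\<lambda>i x. \<Sum>s\<in>S. partial_deriv i (f s) x"])
    show "((\<lambda>t. \<Sum>s\<in>S. f s (x(i := t))) has_field_derivative
        (\<Sum>s\<in>S. partial_deriv i (f s) x)) (at (x i))" if "i \<in> I" "x \<in> punctured I" for i x
      by (rule DERIV_sum) (rule C_diff_has_partial[OF Suc.prems that(2,1)])
    show "C_diff k I (\<lambda>x. \<Sum>s\<in>S. partial_deriv i (f s) x)" if "i \<in> I" for i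
      using that Suc.prems by (intro Suc.IH) auto
  qed (use Suc.prems in \<open>auto intro!: continuous_on_sum\<close>)
qed (auto intro!: continuous_on_sum)

lemma C_diff_add: "C_diff k I f \<Longrightarrow> C_diff k I g \<Longrightarrow> C_diff k I (\<lambda>x. f x + g x)"
  \<comment> \<open>A binary sum is a sum over the two-element index type
    \<open>bool\<close>.\<close>
  using C_diff_sum[of "UNIV :: bool set" k I "\<lambda>s. if s then f else g"]
  by (simp add: UNIV_bool add.commute)

lemma C_diff_mult:
  assumes "C_diff k I f" "C_diff k I g"
  shows "C_diff k I (\<lambda>x. f x * g x)"
  using assms
proof (induction k arbitrary: f g)
  case (Suc k)
  show ?case
  proof (rule C_diff_SucI[where D = "\<lambda>i x. partial_deriv i f x * g x + f x * partial_deriv i g x"])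
    show "((\<lambda>t. f (x(i := t)) * g (x(i := t))) has_field_derivative
        partial_deriv i f x * g x + f x * partial_deriv i g x) (at (x i))"
      if "i \<in> I" "x \<in> punctured I" for i x
      by (rule DERIV_cong[OF DERIV_mult'[OF C_diff_has_partial[OF Suc.prems(1) that(2,1)]
          C_diff_has_partial[OF Suc.prems(2) that(2,1)]]]) simp
    show "C_diff k I (\<lambda>x. partial_deriv i f x * g x + f x * partial_deriv i g x)" if "i \<in> I" for i
      using that Suc.prems C_diff_SucD[OF Suc.prems(1)] C_diff_SucD[OF Suc.prems(2)]
      by (intro C_diff_add Suc.IH) auto
  qed (use Suc.prems in \<open>auto intro!: continuous_on_mult\<close>)
qed (auto intro!: continuous_on_mult)

lemma C_diff_cmult: "C_diff k I f \<Longrightarrow> C_diff k I (\<lambda>x. c * f x)"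
  by (intro C_diff_mult C_diff_const)

text \<open>Away from 0 the sign is locally constant. Signs are therefore smooth functions that tell
  the connected components of the punctured space apart, and they serve below both in base points
  and as cutoffs.\<close>

lemma has_partial_sgn:
  assumes "x \<in> punctured I" "i \<in> I"
  shows "((\<lambda>t. sgn ((x(i := t)) j) :: real) has_field_derivative 0) (at (x i))"
proof (cases "j = i")
  case True
  have "x i \<noteq> 0" using assms by (simp add: punctured_nonzero)
  have "\<forall>\<^sub>F t in nhds (x i). t * x i \<in> {0<..}"
    using \<open>x i \<noteq> 0\<close>
    by (intro topological_tendstoD[OF tendsto_mult[OF filterlim_ident tendsto_const]])
      (auto simp: zero_less_mult_iff)
  then have "\<forall>\<^sub>F t in nhds (x i). sgn ((x(i := t)) j) = sgn (x i)"
    by eventually_elim (auto simp: True zero_less_mult_iff)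
  then show ?thesis
    by (subst DERIV_cong_ev[OF refl _ refl, where g = "\<lambda>t. sgn (x i)"]) auto
qed auto

lemma continuous_on_sgn_component:
  "i \<in> I \<Longrightarrow> continuous_on (punctured I) (\<lambda>x. sgn (x i) :: real)"
  by (intro continuous_on_sgn continuous_on_component) (auto simp: punctured_nonzero)

lemma C_diff_sgn: "i \<in> I \<Longrightarrow> C_diff k I (\<lambda>x. sgn (x i))"
proof (cases k)
  case (Suc k')
  assume "i \<in> I"
  then show ?thesis unfolding Suc
    by (intro C_diff_SucI[where D = "\<lambda>j x. 0"] has_partial_sgn C_diff_const
        continuous_on_sgn_component) auto
qed (auto intro: continuous_on_sgn_component)

section \<open>Pullback along rescaling and freezing of coordinates\<close>

text \<open>Two maps needed later have this form: freezing some coordinates at a base point, and the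
  edge weights as functions of the coordinates at a single vertex. Coordinates in \<open>J\<close>
  are rescaled copies of coordinates of \<open>y\<close>, the others are frozen at
  \<open>z\<close>.\<close>

definition coord_subst ::
  "'i set \<Rightarrow> 'i set \<Rightarrow> ('i \<Rightarrow> 'j) \<Rightarrow> ('i \<Rightarrow> real) \<Rightarrow> ('i \<Rightarrow> real) \<Rightarrow> ('j \<Rightarrow> real) \<Rightarrow> 'i \<Rightarrow> real" where
  "coord_subst I J l s z y = (\<lambda>e\<in>I. if e \<in> J then s e * y (l e) else z e)"

context
  fixes I J :: "'i set" and K :: "'j set" and l :: "'i \<Rightarrow> 'j" and s z :: "'i \<Rightarrow> real"
  assumes JI: "J \<subseteq> I" and inj: "inj_on l J" and lK: "l ` J \<subseteq> K"
    and s: "\<And>e. e \<in> J \<Longrightarrow> s e \<noteq> 0" and z: "\<And>e. e \<in> I - J \<Longrightarrow> z e \<noteq> 0"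
begin

lemma coord_subst_punctured:
  assumes "y \<in> punctured K"
  shows "coord_subst I J l s z y \<in> punctured I"
proof -
  have "coord_subst I J l s z y e \<noteq> 0" if "e \<in> I" for e
  proof (cases "e \<in> J")
    case True
    with lK have "y (l e) \<noteq> 0" by (intro punctured_nonzero[OF assms]) auto
    with True that s show ?thesis by (simp add: coord_subst_def)
  qed (use that z in \<open>simp add: coord_subst_def\<close>)
  then show ?thesis by (simp add: punctured_def PiE_iff coord_subst_def)
qed

lemma continuous_on_coord_subst: "continuous_on A (coord_subst I J l s z)"
proof (rule continuous_on_coordinatewise_then_product)
  show "continuous_on A (\<lambda>y. coord_subst I J l s z y e)" for e
    by (cases "e \<in> I"; cases "e \<in> J")
      (auto simp: coord_subst_def intro!: continuous_intros continuous_on_component)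
qed

text \<open>By injectivity of \<open>l\<close> on \<open>J\<close>, moving one coordinate of
  \<open>y\<close> moves a single coordinate of the image, so the chain rule has only one
  term.\<close>

lemma coord_subst_upd:
  assumes "e \<in> J"
  shows "coord_subst I J l s z (y(l e := t)) = (coord_subst I J l s z y)(e := s e * t)"
  using assms inj JI by (auto simp: coord_subst_def inj_on_eq_iff fun_eq_iff)

lemma coord_subst_upd_other:
  assumes "i \<notin> l ` J"
  shows "coord_subst I J l s z (y(i := t)) = coord_subst I J l s z y"
  using assms by (auto simp: coord_subst_def fun_eq_iff)

lemma has_partial_coord_subst:
  assumes "C_diff (Suc k) I f" "y \<in> punctured K" "e \<in> J"
  shows "((\<lambda>t. f (coord_subst I J l s z (y(l e := t)))) has_field_derivative
          s e * partial_deriv e f (coord_subst I J l s z y)) (at (y (l e)))"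
proof -
  let ?w = "coord_subst I J l s z y"
  have "?w e = s e * y (l e)" using assms JI by (auto simp: coord_subst_def)
  then have "((\<lambda>t. f (?w(e := t))) has_field_derivative partial_deriv e f ?w) (at (s e * y (l e)))"
    using C_diff_has_partial[OF assms(1) coord_subst_punctured[OF assms(2)], of e] assms JI by auto
  then have "((\<lambda>t. f (?w(e := s e * t))) has_field_derivative partial_deriv e f ?w * s e)
      (at (y (l e)))"
    by (rule DERIV_chain2) (auto intro!: derivative_eq_intros)
  then show ?thesis by (simp add: coord_subst_upd[OF assms(3)] mult.commute)
qed

lemma partial_deriv_coord_subst:
  assumes "C_diff (Suc k) I f" "y \<in> punctured K" "e \<in> J"
  shows "partial_deriv (l e) (\<lambda>y. f (coord_subst I J l s z y)) y
          = s e * partial_deriv e f (coord_subst I J l s z y)"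
  by (rule partial_deriv_eq) (rule has_partial_coord_subst[OF assms])

text \<open>A partial derivative of the pullback is a constant times the pullback of a partial
  derivative, or zero for a coordinate outside the image of \<open>l\<close>. The induction on
  \<open>k\<close> therefore stays within pullbacks.\<close>

lemma C_diff_coord_subst:
  assumes "C_diff k I f"
  shows "C_diff k K (\<lambda>y. f (coord_subst I J l s z y))"
  using assms
proof (induction k arbitrary: f)
  case 0
  then show ?case
    by (auto intro!: continuous_on_compose2[OF _ continuous_on_coord_subst] coord_subst_punctured)
next
  case (Suc k)
  show ?case
  proof (rule C_diff_SucI[where D = "\<lambda>i y. if i \<in> l ` J then
        s (inv_into J l i) * partial_deriv (inv_into J l i) f (coord_subst I J l s z y) else 0"])
    show "continuous_on (punctured K) (\<lambda>y. f (coord_subst I J l s z y))"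
      using Suc.prems by (intro continuous_on_compose2[OF _ continuous_on_coord_subst])
        (auto intro: coord_subst_punctured)
  next
    fix i y assume iy: "i \<in> K" "y \<in> punctured K"
    show "((\<lambda>t. f (coord_subst I J l s z (y(i := t)))) has_field_derivative
      (if i \<in> l ` J then s (inv_into J l i) *
         partial_deriv (inv_into J l i) f (coord_subst I J l s z y) else 0)) (at (y i))"
    proof (cases "i \<in> l ` J")
      case True
      then obtain e where e: "e \<in> J" "i = l e" by auto
      show ?thesis using has_partial_coord_subst[OF Suc.prems iy(2) e(1)] e inj by auto
    qed (auto simp: coord_subst_upd_other)
  next
    fix i assume "i \<in> K"
    show "C_diff k K (\<lambda>y. if i \<in> l ` J then s (inv_into J l i) *
         partial_deriv (inv_into J l i) f (coord_subst I J l s z y) else 0)"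
    proof (cases "i \<in> l ` J")
      case True
      then obtain e where e: "e \<in> J" "i = l e" by auto
      then have "C_diff k I (partial_deriv e f)" using Suc.prems JI by auto
      from C_diff_cmult[OF Suc.IH[OF this]] show ?thesis using e inj by auto
    qed (simp add: C_diff_const)
  qed
qed

end

section \<open>Hadamard quotients and symmetry of second derivatives\<close>

text \<open>
  Hadamard quotients along the coordinate \<open>i\<close>. The base point \<open>sgn (x i) * r\<close> lies on the same side
  of \<open>0\<close> as \<open>x i\<close>, which keeps the segment inside the punctured space and makes the quotient smooth on
  all of it. The weights \<open>t ^ m\<close> make the family closed under partial derivatives.
\<close>

definition hadamard_path :: "'i \<Rightarrow> real \<Rightarrow> ('i \<Rightarrow> real) \<Rightarrow> real \<Rightarrow> 'i \<Rightarrow> real" where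
  "hadamard_path i r x t = x(i := (1 - t) * (sgn (x i) * r) + t * x i)"

definition hadamard ::
  "'i \<Rightarrow> real \<Rightarrow> nat \<Rightarrow> (('i \<Rightarrow> real) \<Rightarrow> real) \<Rightarrow> ('i \<Rightarrow> real) \<Rightarrow> real" where
  "hadamard i r m g x = integral (cbox 0 1) (\<lambda>t. t ^ m * g (hadamard_path i r x t))"

text \<open>Factoring out \<open>sgn s\<close> leaves a convex combination of the positive numbers
  \<open>r\<close> and \<open>\<bar>s\<bar>\<close>.\<close>

lemma sgn_homotopy_nonzero:
  fixes s r t :: real
  assumes "s \<noteq> 0" "r > 0" "0 \<le> t" "t \<le> 1"
  shows "(1 - t) * (sgn s * r) + t * s \<noteq> 0"
proof -
  have "(1 - t) * (sgn s * r) + t * s = sgn s * ((1 - t) * r + t * \<bar>s\<bar>)"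
    by (simp add: sgn_if algebra_simps)
  moreover have "(1 - t) * r + t * \<bar>s\<bar> > 0"
  proof (cases "t = 0")
    case False
    with assms show ?thesis by (intro add_nonneg_pos mult_nonneg_nonneg mult_pos_pos) auto
  qed (use assms in simp)
  ultimately show ?thesis using assms(1) by (simp add: sgn_if)
qed

context
  fixes I :: "'i set" and i :: 'i and r :: real
  assumes i: "i \<in> I" and r: "r > 0"
begin

lemma hadamard_path_punctured:
  assumes "x \<in> punctured I" "t \<in> cbox 0 1"
  shows "hadamard_path i r x t \<in> punctured I"
  unfolding hadamard_path_def
  using assms i r by (intro punctured_upd sgn_homotopy_nonzero) (auto simp: punctured_nonzero)

lemma continuous_on_hadamard_path:
  "continuous_on (punctured I \<times> cbox 0 1) (\<lambda>p. hadamard_path i r (fst p) (snd p))"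
proof (rule continuous_on_coordinatewise_then_product)
  have comp: "continuous_on A (\<lambda>p. fst p e)" for A and e :: 'i
    by (rule continuous_on_compose2[where t = UNIV and g = "\<lambda>x. x e"])
      (auto intro: continuous_on_component continuous_intros)
  show "continuous_on (punctured I \<times> cbox 0 1) (\<lambda>p. hadamard_path i r (fst p) (snd p) e)" for e
    using i by (cases "e = i")
      (auto simp: hadamard_path_def punctured_nonzero intro!: continuous_intros comp)
qed

lemma continuous_on_hadamard_integrand:
  assumes "continuous_on (punctured I) g"
  shows "continuous_on (punctured I \<times> cbox 0 1) (\<lambda>(x, t). t ^ m * g (hadamard_path i r x t))"
  unfolding split_def
  by (intro continuous_intros continuous_on_compose2[OF assms continuous_on_hadamard_path])
    (auto intro: hadamard_path_punctured)

lemma hadamard_integrable: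
  assumes "continuous_on (punctured I) g" "x \<in> punctured I"
  shows "(\<lambda>t. t ^ m * g (hadamard_path i r x t)) integrable_on cbox 0 1"
proof -
  have "continuous_on (cbox 0 1) (\<lambda>t. case (x, t) of (x, t) \<Rightarrow> t ^ m * g (hadamard_path i r x t))"
    by (rule continuous_on_compose2[OF continuous_on_hadamard_integrand[OF assms(1)]])
      (use assms(2) in \<open>auto intro!: continuous_intros\<close>)
  then show ?thesis by (intro integrable_continuous) simp
qed

text \<open>Since the sign is locally constant, the point of the path at time \<open>t\<close> moves
  with speed \<open>t\<close> when \<open>x i\<close> moves, and with speed 1 when another
  coordinate does.\<close>

lemma has_partial_hadamard_path:
  assumes g: "C_diff (Suc k) I g" and j: "j \<in> I" and x: "x \<in> punctured I" and t: "t \<in> cbox 0 1"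
  shows "((\<lambda>s. g (hadamard_path i r (x(j := s)) t)) has_field_derivative
      (if j = i then t else 1) * partial_deriv j g (hadamard_path i r x t)) (at (x j))"
proof (cases "j = i")
  case False
  then have "hadamard_path i r (x(j := s)) t = (hadamard_path i r x t)(j := s)" for s
    by (auto simp: hadamard_path_def)
  then show ?thesis
    using C_diff_has_partial[OF g hadamard_path_punctured[OF x t] j] False
    by (simp add: hadamard_path_def)
next
  case True
  let ?q = "\<lambda>s. (1 - t) * (sgn s * r) + t * s"
  have eq: "hadamard_path i r (x(j := s)) t = (hadamard_path i r x t)(j := ?q s)" for s
    by (auto simp: hadamard_path_def True)
  have sgn: "(sgn has_field_derivative 0) (at (x j))"
    using has_partial_sgn[OF x j, of j] by simp
  have q: "(?q has_field_derivative t) (at (x j))"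
    by (rule derivative_eq_intros sgn refl)+ simp
  have "((\<lambda>s. g ((hadamard_path i r x t)(j := s))) has_field_derivative
      partial_deriv j g (hadamard_path i r x t)) (at (?q (x j)))"
    using C_diff_has_partial[OF g hadamard_path_punctured[OF x t] j] True
    by (simp add: hadamard_path_def)
  from DERIV_chain2[OF this q] show ?thesis
    unfolding eq by (rule DERIV_cong) (simp add: True)
qed

text \<open>Differentiation under the integral sign. The factor \<open>t\<close> arising in
  direction \<open>i\<close> is absorbed by raising the exponent \<open>m\<close>.\<close>

lemma has_partial_hadamard:
  assumes g: "C_diff (Suc k) I g" and j: "j \<in> I" and x: "x \<in> punctured I"
  shows "((\<lambda>s. hadamard i r m g (x(j := s))) has_field_derivative
      hadamard i r (if j = i then Suc m else m) (partial_deriv j g) x) (at (x j))"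
proof -
  \<comment> \<open>The half line on the side of \<open>x j\<close>: convex for the Leibniz rule on
    parameter integrals, open so that the derivative within it is an ordinary one, and free of
    0.\<close>
  define U where "U = {s. s * x j > 0}"
  let ?m = "if j = i then Suc m else m"
  have xj: "x j \<noteq> 0" using x j by (rule punctured_nonzero)
  have U: "open U" "convex U" "x j \<in> U"
  proof -
    have "U = {s. x j \<bullet> s > 0}" by (simp add: U_def mult.commute)
    then show "open U" "convex U"
      using open_halfspace_gt[of 0 "x j"] convex_halfspace_gt[of 0 "x j"] by simp_all
    show "x j \<in> U" using xj by (auto simp: U_def zero_less_mult_iff)
  qed
  have xs: "x(j := s) \<in> punctured I" if "s \<in> U" for s
    using that x j by (intro punctured_upd) (auto simp: U_def)
  have cg: "continuous_on (punctured I) (partial_deriv j g)"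
    using g j by (auto intro: C_diff_imp_continuous_on)
  have "((\<lambda>s. integral (cbox 0 1) (\<lambda>t. t ^ m * g (hadamard_path i r (x(j := s)) t)))
     has_field_derivative
      integral (cbox 0 1) (\<lambda>t. t ^ ?m * partial_deriv j g (hadamard_path i r (x(j := x j)) t)))
     (at (x j) within U)"
  proof (rule leibniz_rule_field_derivative)
    fix s t :: real assume st: "s \<in> U" "t \<in> cbox 0 1"
    have "((\<lambda>s. g (hadamard_path i r (x(j := s)) t)) has_field_derivative
      (if j = i then t else 1) * partial_deriv j g (hadamard_path i r (x(j := s)) t)) (at s)"
      using has_partial_hadamard_path[OF g j xs[OF st(1)] st(2)] by simp
    from DERIV_cmult[OF this, of "t ^ m"]
    show "((\<lambda>s. t ^ m * g (hadamard_path i r (x(j := s)) t)) has_field_derivative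
       t ^ ?m * partial_deriv j g (hadamard_path i r (x(j := s)) t)) (at s within U)"
      by (auto intro!: has_field_derivative_at_within simp: mult_ac split: if_splits)
  next
    show "(\<lambda>t. t ^ m * g (hadamard_path i r (x(j := s)) t)) integrable_on cbox 0 1" if "s \<in> U" for s
      using that by (intro hadamard_integrable[OF C_diff_imp_continuous_on[OF g]] xs)
  next
    have upd: "continuous_on A (\<lambda>s. x(j := s))" for A
    proof (rule continuous_on_coordinatewise_then_product)
      show "continuous_on A (\<lambda>s. (x(j := s)) e)" for e
        by (cases "e = j") (auto intro: continuous_intros)
    qed
    have pair: "continuous_on (U \<times> cbox 0 1) (\<lambda>p. (x(j := fst p), snd p :: real))"
      by (intro continuous_intros continuous_on_compose2[OF upd[of UNIV]]) auto
    have img: "(\<lambda>p. (x(j := fst p), snd p)) ` (U \<times> cbox 0 1) \<subseteq> punctured I \<times> cbox 0 1"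
      using xs by auto
    show "continuous_on (U \<times> cbox 0 1)
       (\<lambda>(s, t). t ^ ?m * partial_deriv j g (hadamard_path i r (x(j := s)) t))"
      using continuous_on_compose2[OF continuous_on_hadamard_integrand[OF cg, of ?m] pair img]
      by (simp add: split_def)
  qed (use U in auto)
  then show ?thesis
    by (simp only: hadamard_def at_within_open[OF U(3,1)] fun_upd_triv)
qed

lemma C_diff_hadamard: "C_diff k I g \<Longrightarrow> C_diff k I (hadamard i r m g)"
proof (induction k arbitrary: g m)
  case 0
  then show ?case
    unfolding hadamard_def[abs_def] C_diff.simps
    by (intro integral_continuous_on_param continuous_on_hadamard_integrand)
next
  case (Suc k)
  show ?case
  proof (rule C_diff_SucI)
    show "continuous_on (punctured I) (hadamard i r m g)"
      unfolding hadamard_def[abs_def] using Suc.prems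
      by (intro integral_continuous_on_param continuous_on_hadamard_integrand) auto
    show "((\<lambda>s. hadamard i r m g (x(j := s))) has_field_derivative
      hadamard i r (if j = i then Suc m else m) (partial_deriv j g) x) (at (x j))"
      if "j \<in> I" "x \<in> punctured I" for j x
      using Suc.prems that by (rule has_partial_hadamard)
    show "C_diff k I (hadamard i r (if j = i then Suc m else m) (partial_deriv j g))"
      if "j \<in> I" for j
      using that Suc.prems by (intro Suc.IH) auto
  qed
qed

text \<open>The fundamental theorem of calculus along the path, which ends in \<open>x\<close> and
  starts in the point whose coordinate \<open>i\<close> is the base value.\<close>

lemma hadamard_expansion:
  assumes f: "C_diff (Suc k) I f" and x: "x \<in> punctured I"
  shows "f x = f (x(i := sgn (x i) * r))
    + (x i - sgn (x i) * r) * hadamard i r 0 (partial_deriv i f) x"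
proof -
  let ?c = "sgn (x i) * r"
  have "((\<lambda>t. (x i - ?c) * partial_deriv i f (hadamard_path i r x t)) has_integral
      f (hadamard_path i r x 1) - f (hadamard_path i r x 0)) {0..1}"
  proof (rule fundamental_theorem_of_calculus)
    fix t :: real assume t: "t \<in> {0..1}"
    define p where "p = hadamard_path i r x t"
    let ?q = "\<lambda>t. (1 - t) * ?c + t * x i"
    have eq: "hadamard_path i r x t' = p(i := ?q t')" for t'
      by (auto simp: p_def hadamard_path_def)
    have "((\<lambda>s. f (p(i := s))) has_field_derivative partial_deriv i f p) (at (?q t))"
      using C_diff_has_partial[OF f hadamard_path_punctured[OF x, of t] i] t
      by (simp add: p_def hadamard_path_def)
    moreover have "(?q has_field_derivative (x i - ?c)) (at t)"
      by (auto intro!: derivative_eq_intros)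
    ultimately have "((\<lambda>t'. f (p(i := ?q t'))) has_field_derivative
        partial_deriv i f p * (x i - ?c)) (at t)"
      by (rule DERIV_chain2)
    then have "((\<lambda>t. f (hadamard_path i r x t)) has_field_derivative
        (x i - ?c) * partial_deriv i f p) (at t)"
      unfolding eq by (rule DERIV_cong) (simp add: mult.commute)
    then show "((\<lambda>t. f (hadamard_path i r x t)) has_vector_derivative
        (x i - ?c) * partial_deriv i f (hadamard_path i r x t)) (at t within {0..1})"
      unfolding p_def[symmetric] has_real_derivative_iff_has_vector_derivative
      by (rule has_vector_derivative_at_within)
  qed simp
  then have "integral {0..1} (\<lambda>t. (x i - ?c) * partial_deriv i f (hadamard_path i r x t))
      = f (hadamard_path i r x 1) - f (hadamard_path i r x 0)"
    by (rule integral_unique)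
  then show ?thesis
    by (simp add: hadamard_def hadamard_path_def)
qed

end

text \<open>For \<open>r = \<bar>x i\<bar>\<close> the path is constant. Thus the Hadamard quotient
  of \<open>f\<close> takes the value of the partial derivative at the base point.\<close>

lemma hadamard_base: "hadamard i \<bar>x i\<bar> 0 g x = g x"
proof -
  have "(1 - t) * (sgn (x i) * \<bar>x i\<bar>) + t * x i = x i" for t
    by (simp only: sgn_mult_abs) (simp add: algebra_simps)
  then have "hadamard_path i \<bar>x i\<bar> x t = x" for t
    by (simp add: hadamard_path_def)
  then show ?thesis by (simp add: hadamard_def)
qed

text \<open>Differentiating the Hadamard expansion of \<open>f\<close> along \<open>i\<close>, based at \<open>x\<close>, first in
  direction \<open>j\<close> and then in direction \<open>i\<close>.\<close>

lemma partial_deriv_commute: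
  assumes f: "C_diff (Suc (Suc k)) I f" and x: "x \<in> punctured I" and i: "i \<in> I" and j: "j \<in> I"
  shows "partial_deriv i (partial_deriv j f) x = partial_deriv j (partial_deriv i f) x"
proof (cases "i = j")
  case False
  define r where "r = \<bar>x i\<bar>"
  have xi: "x i \<noteq> 0" using x i by (rule punctured_nonzero)
  then have r: "r > 0" by (simp add: r_def)
  have f1: "C_diff (Suc k) I f" using f by (rule C_diff_SucD)
  have fi: "C_diff (Suc k) I (partial_deriv i f)" and fj: "C_diff (Suc k) I (partial_deriv j f)"
    using f i j by auto
  let ?h = "hadamard i r 0 (partial_deriv j (partial_deriv i f))"
  \<comment> \<open>The expansion of \<open>f\<close> is differentiated in direction
    \<open>j\<close>; the factor \<open>y i - sgn (y i) * r\<close> is constant in that direction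
    because \<open>i\<close> and \<open>j\<close> differ.\<close>
  have key: "partial_deriv j f y = partial_deriv j f (y(i := sgn (y i) * r))
      + (y i - sgn (y i) * r) * ?h y" if y: "y \<in> punctured I" for y
  proof -
    have y': "y(i := sgn (y i) * r) \<in> punctured I" (is "?y \<in> _")
      using y i r by (intro punctured_upd) (auto simp: punctured_nonzero sgn_if)
    have "((\<lambda>s. f (?y(j := s)) + (y i - sgn (y i) * r) * hadamard i r 0 (partial_deriv i f) (y(j := s)))
        has_field_derivative partial_deriv j f ?y + (y i - sgn (y i) * r) * ?h y) (at (y j))"
      using C_diff_has_partial[OF f1 y' j] has_partial_hadamard[OF i r fi j y, of 0] False
      by (intro DERIV_add DERIV_cmult) auto
    moreover have eq: "f (?y(j := s)) + (y i - sgn (y i) * r) * hadamard i r 0 (partial_deriv i f) (y(j := s))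
        = f (y(j := s))" if "s \<noteq> 0" for s
      using hadamard_expansion[OF i r f1 punctured_upd[OF y j that]] False
      by (simp add: fun_upd_twist)
    have "\<forall>\<^sub>F s in nhds (y j). s \<in> - {0}"
      using punctured_nonzero[OF y j] by (intro eventually_nhds_in_open) auto
    then have "\<forall>\<^sub>F s in nhds (y j). f (?y(j := s)) + (y i - sgn (y i) * r)
        * hadamard i r 0 (partial_deriv i f) (y(j := s)) = f (y(j := s))"
      by eventually_elim (rule eq, simp)
    ultimately have "((\<lambda>s. f (y(j := s))) has_field_derivative
        partial_deriv j f ?y + (y i - sgn (y i) * r) * ?h y) (at (y j))"
      by (subst (asm) DERIV_cong_ev[OF refl _ refl])
    then show ?thesis by (rule partial_deriv_eq)
  qed
  have "((\<lambda>s. partial_deriv j f (x(i := s))) has_field_derivative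
      partial_deriv i (partial_deriv j f) x) (at (x i))"
    by (rule C_diff_has_partial[OF fj x i])
  \<comment> \<open>On the side of \<open>x i\<close> the base coordinate is \<open>x i\<close>
    itself, so \<open>key\<close> exhibits the difference quotient as a value of the continuous
    function \<open>?h\<close>.\<close>
  moreover have "((\<lambda>s. partial_deriv j f (x(i := s))) has_field_derivative ?h x) (at (x i))"
  proof -
    have "continuous_on (punctured I) ?h"
      using fi j by (intro C_diff_imp_continuous_on[of k] C_diff_hadamard[OF i r]) auto
    moreover have "continuous_on (- {0}) (\<lambda>s. x(i := s))"
    proof (rule continuous_on_coordinatewise_then_product)
      show "continuous_on (- {0}) (\<lambda>s. (x(i := s)) e)" for e
        by (cases "e = i") (auto intro: continuous_intros)
    qed
    ultimately have "continuous_on (- {0}) (\<lambda>s. ?h (x(i := s)))"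
      by (rule continuous_on_compose2) (use punctured_upd[OF x i] in blast)
    then have "isCont (\<lambda>s. ?h (x(i := s))) (x i)"
      using xi by (subst (asm) continuous_on_eq_continuous_at) auto
    moreover have "partial_deriv j f (x(i := s)) - partial_deriv j f x = ?h (x(i := s)) * (s - x i)"
      if "sgn s = sgn (x i)" for s
    proof -
      have "s \<noteq> 0" using that xi by (auto simp: sgn_if split: if_splits)
      moreover have "sgn (x i) * r = x i" by (simp add: r_def sgn_mult_abs)
      ultimately show ?thesis
        using key[OF punctured_upd[OF x i, of s]] that by (simp add: algebra_simps)
    qed
    moreover have "\<forall>\<^sub>F s in at (x i). sgn s = sgn (x i)"
    proof -
      have "\<forall>\<^sub>F s in at (x i). s * x i \<in> {0<..}"
        using xi by (intro topological_tendstoD[OF tendsto_mult[OF tendsto_ident_at tendsto_const]])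
          (auto simp: zero_less_mult_iff)
      then show ?thesis by eventually_elim (auto simp: zero_less_mult_iff)
    qed
    ultimately show ?thesis
      unfolding has_field_derivative_iff isCont_def
      by (subst tendsto_cong[where g = "\<lambda>s. ?h (x(i := s))"])
        (auto elim!: eventually_mono simp: eventually_at_filter)
  qed
  ultimately have "partial_deriv i (partial_deriv j f) x = ?h x"
    by (rule DERIV_unique)
  then show ?thesis by (simp add: r_def hadamard_base)
qed simp

section \<open>Poisson brackets as biderivations\<close>

text \<open>Dropping the extensionality built into \<open>smooth_functions\<close> lets plain lambda
  terms be combined; \<open>restrict_smooth_functions\<close> leads back.\<close>

definition C_inf :: "'i set \<Rightarrow> (('i \<Rightarrow> real) \<Rightarrow> real) \<Rightarrow> bool" where
  "C_inf I f \<longleftrightarrow> (\<forall>k. C_diff k I f)"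

lemma C_infD: "C_inf I f \<Longrightarrow> C_diff k I f"
  by (simp add: C_inf_def)

lemma C_inf_const: "C_inf I (\<lambda>x. c)"
  and C_inf_component: "C_inf I (\<lambda>x. x i)"
  and C_inf_sgn: "i \<in> I \<Longrightarrow> C_inf I (\<lambda>x. sgn (x i))"
  and C_inf_add: "C_inf I f \<Longrightarrow> C_inf I g \<Longrightarrow> C_inf I (\<lambda>x. f x + g x)"
  and C_inf_mult: "C_inf I f \<Longrightarrow> C_inf I g \<Longrightarrow> C_inf I (\<lambda>x. f x * g x)"
  and C_inf_cmult: "C_inf I f \<Longrightarrow> C_inf I (\<lambda>x. c * f x)"
  by (simp_all add: C_inf_def C_diff_const C_diff_component C_diff_sgn C_diff_add C_diff_mult
      C_diff_cmult)

lemma C_inf_sum: "(\<And>s. s \<in> S \<Longrightarrow> C_inf I (f s)) \<Longrightarrow> C_inf I (\<lambda>x. \<Sum>s\<in>S. f s x)"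
  by (simp add: C_inf_def C_diff_sum)

lemma C_inf_diff: "C_inf I f \<Longrightarrow> C_inf I g \<Longrightarrow> C_inf I (\<lambda>x. f x - g x)"
  using C_inf_add[of I f "\<lambda>x. - 1 * g x"] C_inf_cmult[of I g "- 1"] by simp

lemma C_inf_hadamard: "i \<in> I \<Longrightarrow> r > 0 \<Longrightarrow> C_inf I g \<Longrightarrow> C_inf I (hadamard i r m g)"
  by (simp add: C_inf_def C_diff_hadamard)

lemma C_inf_partial_deriv: "C_inf I f \<Longrightarrow> i \<in> I \<Longrightarrow> C_inf I (partial_deriv i f)"
  unfolding C_inf_def using C_diff.simps(2) by metis

lemma C_inf_cong:
  "(\<And>x. x \<in> punctured I \<Longrightarrow> f x = g x) \<Longrightarrow> C_inf I f \<longleftrightarrow> C_inf I g"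
  unfolding C_inf_def using C_diff_cong[of I f g] by simp

lemma C_inf_has_partial:
  assumes "C_inf I f" "x \<in> punctured I" "i \<in> I"
  shows "((\<lambda>t. f (x(i := t))) has_field_derivative partial_deriv i f x) (at (x i))"
  by (rule C_diff_has_partial[OF C_infD[OF assms(1)] assms(2,3)])

lemma smooth_functions_iff:
  "f \<in> smooth_functions I \<longleftrightarrow> f \<in> extensional (punctured I) \<and> C_inf I f"
  by (simp add: smooth_functions_def C_inf_def)

lemma smooth_functions_C_inf: "f \<in> smooth_functions I \<Longrightarrow> C_inf I f"
  by (simp add: smooth_functions_iff)

lemma restrict_smooth_functions: "C_inf I f \<Longrightarrow> restrict f (punctured I) \<in> smooth_functions I"
  unfolding smooth_functions_iff by (subst C_inf_cong[where g = f]) auto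

lemma restrict_smooth_eq: "f \<in> smooth_functions I \<Longrightarrow> restrict f (punctured I) = f"
  by (simp add: smooth_functions_iff extensional_restrict)

lemma coord_smooth_functions: "coord I i \<in> smooth_functions I"
  unfolding coord_def by (rule restrict_smooth_functions) (rule C_inf_component)

lemma partial_deriv_coord:
  assumes "x \<in> punctured I" "i \<in> I"
  shows "partial_deriv i (coord I j) x = (if i = j then 1 else 0)"
proof -
  have "partial_deriv i (coord I j) x = partial_deriv i (\<lambda>x. x j) x"
    by (rule partial_deriv_cong[OF _ assms]) (simp add: coord_def)
  also have "\<dots> = (if i = j then 1 else 0)"
    by (rule partial_deriv_eq) (auto intro!: derivative_eq_intros)
  finally show ?thesis .
qed

section \<open>Point derivations and their expansion in partial derivatives\<close>

text \<open>The model is \<open>f\<close> mapped to the value at \<open>a\<close> of its bracket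
  with a fixed function. As \<open>D\<close> acts on total functions, \<open>cong\<close> is what
  confines it to values on the punctured space.\<close>

locale point_derivation =
  fixes I :: "'i set" and a :: "'i \<Rightarrow> real" and D :: "(('i \<Rightarrow> real) \<Rightarrow> real) \<Rightarrow> real"
  assumes a: "a \<in> punctured I"
    and lin: "\<And>f g p q. C_inf I f \<Longrightarrow> C_inf I g \<Longrightarrow> D (\<lambda>x. p * f x + q * g x) = p * D f + q * D g"
    and leibniz: "\<And>f g. C_inf I f \<Longrightarrow> C_inf I g \<Longrightarrow> D (\<lambda>x. f x * g x) = f a * D g + D f * g a"
    and cong: "\<And>f g. (\<And>x. x \<in> punctured I \<Longrightarrow> f x = g x) \<Longrightarrow> D f = D g"
begin

text \<open>The Leibniz rule for the product 1 * 1 shows that \<open>D\<close> sends 1 to twice its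
  own value there.\<close>

lemma D_const: "D (\<lambda>x. c) = 0"
proof -
  have "D (\<lambda>x. 1) = 0"
    using leibniz[of "\<lambda>x. 1" "\<lambda>x. 1"] by (simp add: C_inf_const)
  then show ?thesis
    using lin[of "\<lambda>x. 1" "\<lambda>x. 1" c 0] by (simp add: C_inf_const)
qed

lemma D_diff: "C_inf I f \<Longrightarrow> C_inf I g \<Longrightarrow> D (\<lambda>x. f x - g x) = D f - D g"
  using lin[of f g 1 "- 1"] by simp

text \<open>With \<open>e\<close> as a cutoff, the Leibniz rule for the vanishing product leaves
  only \<open>e a * D u\<close>. This replaces a separate proof that \<open>D\<close> is
  local.\<close>

lemma D_eq_0:
  assumes "C_inf I e" "C_inf I u" "\<And>x. x \<in> punctured I \<Longrightarrow> e x * u x = 0" "e a \<noteq> 0" "u a = 0"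
  shows "D u = 0"
proof -
  have "D (\<lambda>x. e x * u x) = 0"
    using cong[of "\<lambda>x. e x * u x" "\<lambda>x. 0"] assms(3) D_const by simp
  with leibniz[OF assms(1,2)] assms(4,5) show ?thesis by simp
qed

text \<open>The expansion is only available on the half space \<open>sgn (x i) = sgn (a i)\<close>; the locally
  constant factor \<open>1 + sgn (x i) * sgn (a i)\<close> vanishes on the other one.\<close>

lemma D_freeze_coordinate:
  assumes f: "C_inf I f" and f': "C_inf I (\<lambda>x. f (x(i := a i)))" and i: "i \<in> I"
  shows "D f = D (\<lambda>x. f (x(i := a i))) + partial_deriv i f a * D (\<lambda>x. x i)"
proof -
  define h where "h = hadamard i \<bar>a i\<bar> 0 (partial_deriv i f)"
  have r: "\<bar>a i\<bar> > 0" using punctured_nonzero[OF a i] by simp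
  have h: "C_inf I h"
    unfolding h_def using i r f by (intro C_inf_hadamard C_inf_partial_deriv)
  let ?u = "\<lambda>x. f x - f (x(i := a i)) - (x i - a i) * h x"
  let ?e = "\<lambda>x. 1 + sgn (a i) * sgn (x i)"
  note sm = C_inf_diff C_inf_mult C_inf_add C_inf_cmult C_inf_sgn C_inf_const C_inf_component
  have "D ?u = 0"
  proof (rule D_eq_0[where e = ?e])
    fix x assume x: "x \<in> punctured I"
    have "?e x = 0 \<or> sgn (x i) = sgn (a i)"
      using punctured_nonzero[OF x i] punctured_nonzero[OF a i] by (auto simp: sgn_if)
    moreover have "?u x = 0" if "sgn (x i) = sgn (a i)"
      using hadamard_expansion[OF i r C_infD[OF f] x] that by (simp add: h_def sgn_mult_abs)
    ultimately show "?e x * ?u x = 0" by auto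
  next
    show "?e a \<noteq> 0" using r by (auto simp: sgn_if)
  qed (use f f' h i in \<open>auto intro!: sm\<close>)
  \<comment> \<open>The factor \<open>x i - a i\<close> vanishes at \<open>a\<close>, so the Leibniz
    rule keeps only the term in which \<open>D\<close> falls on this factor.\<close>
  moreover have "D ?u = D f - D (\<lambda>x. f (x(i := a i))) - h a * D (\<lambda>x. x i)"
    using f f' h by (simp add: D_diff leibniz D_const sm)
  moreover have "h a = partial_deriv i f a"
    by (simp add: h_def hadamard_base)
  ultimately show ?thesis by simp
qed

text \<open>Coordinates are frozen at their values in \<open>a\<close> one after the other, each
  contributing one summand. Once all are frozen a constant remains, which \<open>D\<close>
  annihilates.\<close>

lemma D_eq_sum_partial_deriv:
  assumes f: "C_inf I f" and I: "finite I"
  shows "D f = (\<Sum>i\<in>I. partial_deriv i f a * D (\<lambda>x. x i))"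
proof -
  define frz where "frz F = coord_subst I (I - F) (\<lambda>j. j) (\<lambda>j. 1) a" for F
  have frz: "C_inf I (\<lambda>x. f (frz F x))" for F
    unfolding C_inf_def frz_def using punctured_nonzero[OF a] C_infD[OF f]
    by (intro allI C_diff_coord_subst) auto
  have ext: "x \<in> extensional I" if "x \<in> punctured I" for x :: "'i \<Rightarrow> real"
    using that by (simp add: punctured_def PiE_def)
  have "D f = (\<Sum>i\<in>F. partial_deriv i f a * D (\<lambda>x. x i)) + D (\<lambda>x. f (frz F x))"
    if "F \<subseteq> I" for F
    using finite_subset[OF that I] that
  proof (induction F rule: finite_induct)
    case empty
    have "frz {} x = x" if "x \<in> punctured I" for x
      using ext[OF that] by (auto simp: frz_def coord_subst_def extensional_def)
    then have "D f = D (\<lambda>x. f (frz {} x))" by (intro cong) simp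
    then show ?case by simp
  next
    case (insert i F)
    then have i: "i \<in> I" "i \<notin> F" "F \<subseteq> I" by auto
    have eq: "frz F (x(i := a i)) = frz (insert i F) x" for x
      using i by (auto simp: frz_def coord_subst_def)
    \<comment> \<open>The coordinates already frozen have their values from \<open>a\<close>, so
      freezing them does not affect the partial derivative along \<open>i\<close> at
      \<open>a\<close> itself.\<close>
    have "frz F (a(i := t)) = a(i := t)" for t
      using i ext[OF a] by (auto simp: frz_def coord_subst_def extensional_def)
    then have "partial_deriv i (\<lambda>x. f (frz F x)) a = partial_deriv i f a"
      by (simp add: partial_deriv_def)
    then have "D (\<lambda>x. f (frz F x))
        = D (\<lambda>x. f (frz (insert i F) x)) + partial_deriv i f a * D (\<lambda>x. x i)"
      using D_freeze_coordinate[OF frz[of F] _ i(1)] frz[of "insert i F"] by (simp add: eq)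
    with insert i show ?case by simp
  qed
  from this[of I] have "D f = (\<Sum>i\<in>I. partial_deriv i f a * D (\<lambda>x. x i)) + D (\<lambda>x. f (frz I x))"
    by simp
  moreover have "frz I x = a" for x
    using ext[OF a] by (auto simp: frz_def coord_subst_def extensional_def)
  ultimately show ?thesis by (simp add: D_const)
qed

end

section \<open>Expansion of a Poisson bracket in brackets of coordinates\<close>

lemma
  assumes "poisson_bracket I B"
  shows poisson_bracket_funcset: "B \<in> smooth_functions I \<rightarrow>\<^sub>E (smooth_functions I \<rightarrow>\<^sub>E smooth_functions I)"
    and poisson_bracket_antisym: "\<And>f g. f \<in> smooth_functions I \<Longrightarrow> g \<in> smooth_functions I \<Longrightarrow>
      B f g = (\<lambda>x\<in>punctured I. - B g f x)"
    and poisson_bracket_linear: "\<And>f g h p q. f \<in> smooth_functions I \<Longrightarrow> g \<in> smooth_functions I \<Longrightarrow>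
      h \<in> smooth_functions I \<Longrightarrow>
      B (\<lambda>x\<in>punctured I. p * f x + q * g x) h = (\<lambda>x\<in>punctured I. p * B f h x + q * B g h x)"
    and poisson_bracket_leibniz: "\<And>f g h. f \<in> smooth_functions I \<Longrightarrow> g \<in> smooth_functions I \<Longrightarrow>
      h \<in> smooth_functions I \<Longrightarrow>
      B (\<lambda>x\<in>punctured I. f x * g x) h = (\<lambda>x\<in>punctured I. f x * B g h x + B f h x * g x)"
  using assms unfolding poisson_bracket_def by blast+

lemma poisson_bracket_point_derivation:
  assumes B: "poisson_bracket I B" and g: "g \<in> smooth_functions I" and a: "a \<in> punctured I"
  shows "point_derivation I a (\<lambda>f. B (restrict f (punctured I)) g a)"
proof
  fix f h and p q :: real assume "C_inf I f" "C_inf I h"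
  note S = this[THEN restrict_smooth_functions]
  show "B (\<lambda>x\<in>punctured I. p * f x + q * h x) g a =
      p * B (restrict f (punctured I)) g a + q * B (restrict h (punctured I)) g a"
    using fun_cong[OF poisson_bracket_linear[OF B S g, of p q], of a] a
    by (simp cong: restrict_cong)
  show "B (\<lambda>x\<in>punctured I. f x * h x) g a =
      f a * B (restrict h (punctured I)) g a + B (restrict f (punctured I)) g a * h a"
    using fun_cong[OF poisson_bracket_leibniz[OF B S g], of a] a
    by (simp cong: restrict_cong)
next
  fix f h :: "('a \<Rightarrow> real) \<Rightarrow> real" assume "\<And>x. x \<in> punctured I \<Longrightarrow> f x = h x"
  then have "restrict f (punctured I) = restrict h (punctured I)"
    by (rule restrict_ext)
  then show "B (restrict f (punctured I)) g a = B (restrict h (punctured I)) g a" by simp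
qed (fact a)

text \<open>The bracket is a point derivation in its first argument; antisymmetry carries the
  expansion over to the second one.\<close>

lemma poisson_bracket_expansion:
  assumes B: "poisson_bracket I B" and I: "finite I" and x: "x \<in> punctured I"
    and f: "f \<in> smooth_functions I" and g: "g \<in> smooth_functions I"
  shows "B f g x = (\<Sum>i\<in>I. \<Sum>j\<in>I. partial_deriv i f x * partial_deriv j g x
      * B (coord I i) (coord I j) x)"
proof -
  have left: "B f g x = (\<Sum>i\<in>I. partial_deriv i f x * B (coord I i) g x)"
    if "f \<in> smooth_functions I" "g \<in> smooth_functions I" for f g
    using point_derivation.D_eq_sum_partial_deriv[OF
        poisson_bracket_point_derivation[OF B that(2) x] smooth_functions_C_inf[OF that(1)] I]
    by (simp add: restrict_smooth_eq[OF that(1)] coord_def)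
  have flip: "B f g x = - B g f x" if "f \<in> smooth_functions I" "g \<in> smooth_functions I" for f g
    using fun_cong[OF poisson_bracket_antisym[OF B that], of x] x by simp
  have "B (coord I i) g x = (\<Sum>j\<in>I. partial_deriv j g x * B (coord I i) (coord I j) x)" for i
  proof -
    have "B (coord I i) g x = - (\<Sum>j\<in>I. partial_deriv j g x * B (coord I j) (coord I i) x)"
      using flip[OF coord_smooth_functions g] left[OF g coord_smooth_functions] by simp
    also have "\<dots> = (\<Sum>j\<in>I. partial_deriv j g x * B (coord I i) (coord I j) x)"
      by (subst sum_negf[symmetric], intro sum.cong refl)
        (subst flip[OF coord_smooth_functions coord_smooth_functions], simp)
    finally show ?thesis .
  qed
  then show ?thesis
    by (subst left[OF f g]) (simp add: sum_distrib_left mult_ac)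
qed

section \<open>Log-canonical brackets\<close>

text \<open>The derivative with respect to \<open>ln \<bar>x i\<bar>\<close>. In terms of these
  derivatives a log-canonical bracket has constant coefficients.\<close>

definition log_deriv :: "'i \<Rightarrow> (('i \<Rightarrow> real) \<Rightarrow> real) \<Rightarrow> ('i \<Rightarrow> real) \<Rightarrow> real" where
  "log_deriv i f x = x i * partial_deriv i f x"

definition log_bracket :: "'i set \<Rightarrow> ('i \<Rightarrow> 'i \<Rightarrow> real) \<Rightarrow> 'i bracket" where
  "log_bracket I c = (\<lambda>f\<in>smooth_functions I. \<lambda>g\<in>smooth_functions I. \<lambda>x\<in>punctured I.
     \<Sum>i\<in>I. \<Sum>j\<in>I. c i j * log_deriv i f x * log_deriv j g x)"

lemma log_bracket_apply:
  "f \<in> smooth_functions I \<Longrightarrow> g \<in> smooth_functions I \<Longrightarrow> x \<in> punctured I \<Longrightarrow>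
   log_bracket I c f g x = (\<Sum>i\<in>I. \<Sum>j\<in>I. c i j * log_deriv i f x * log_deriv j g x)"
  by (simp add: log_bracket_def)

lemma C_inf_log_deriv: "C_inf I f \<Longrightarrow> i \<in> I \<Longrightarrow> C_inf I (log_deriv i f)"
  unfolding log_deriv_def[abs_def]
  by (intro C_inf_mult C_inf_component C_inf_partial_deriv)

lemma log_deriv_cong:
  "(\<And>y. y \<in> punctured I \<Longrightarrow> f y = g y) \<Longrightarrow> x \<in> punctured I \<Longrightarrow> i \<in> I \<Longrightarrow>
   log_deriv i f x = log_deriv i g x"
  by (simp add: log_deriv_def partial_deriv_cong[of I f g])

lemma log_deriv_eq:
  assumes "C_inf I f" "x \<in> punctured I" "i \<in> I"
    and "((\<lambda>t. f (x(i := t))) has_field_derivative d) (at (x i))"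
  shows "log_deriv i f x = x i * d"
  using DERIV_unique[OF C_inf_has_partial[OF assms(1-3)] assms(4)] by (simp add: log_deriv_def)

lemma log_deriv_lincomb:
  assumes "C_inf I f" "C_inf I g" "x \<in> punctured I" "i \<in> I"
  shows "log_deriv i (\<lambda>x. p * f x + q * g x) x = p * log_deriv i f x + q * log_deriv i g x"
proof -
  have "((\<lambda>t. p * f (x(i := t)) + q * g (x(i := t))) has_field_derivative
      p * partial_deriv i f x + q * partial_deriv i g x) (at (x i))"
    by (intro DERIV_add DERIV_cmult C_inf_has_partial[OF _ assms(3,4)] assms)
  from log_deriv_eq[OF _ assms(3,4) this] assms show ?thesis
    by (simp add: C_inf_add C_inf_cmult log_deriv_def algebra_simps)
qed

lemma log_deriv_mult:
  assumes "C_inf I f" "C_inf I g" "x \<in> punctured I" "i \<in> I"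
  shows "log_deriv i (\<lambda>x. f x * g x) x = f x * log_deriv i g x + log_deriv i f x * g x"
proof -
  have "((\<lambda>t. f (x(i := t)) * g (x(i := t))) has_field_derivative
      f (x(i := x i)) * partial_deriv i g x + partial_deriv i f x * g (x(i := x i))) (at (x i))"
    by (intro DERIV_mult' C_inf_has_partial[OF _ assms(3,4)] assms)
  from log_deriv_eq[OF _ assms(3,4) this] assms show ?thesis
    by (simp add: C_inf_mult log_deriv_def algebra_simps)
qed

lemma log_deriv_sum:
  assumes "\<And>s. s \<in> S \<Longrightarrow> C_inf I (f s)" "x \<in> punctured I" "i \<in> I"
  shows "log_deriv i (\<lambda>x. \<Sum>s\<in>S. f s x) x = (\<Sum>s\<in>S. log_deriv i (f s) x)"
proof -
  have "((\<lambda>t. \<Sum>s\<in>S. f s (x(i := t))) has_field_derivative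
      (\<Sum>s\<in>S. partial_deriv i (f s) x)) (at (x i))"
    by (rule DERIV_sum) (rule C_inf_has_partial[OF assms])
  from log_deriv_eq[OF C_inf_sum[OF assms(1)] assms(2,3) this] show ?thesis
    by (simp add: log_deriv_def sum_distrib_left)
qed

lemma log_deriv_component:
  assumes "x \<in> punctured I" "i \<in> I"
  shows "log_deriv i (\<lambda>x. x j) x = (if i = j then x i else 0)"
proof -
  have "partial_deriv i (\<lambda>x. x j) x = (if i = j then 1 else 0)"
    by (rule partial_deriv_eq) (auto intro!: derivative_eq_intros)
  then show ?thesis by (simp add: log_deriv_def)
qed

text \<open>For distinct indices both sides are \<open>x i * x j\<close> times a mixed second
  partial derivative, and mixed partial derivatives commute.\<close>

lemma log_deriv_commute:
  assumes f: "C_inf I f" and x: "x \<in> punctured I" and i: "i \<in> I" and j: "j \<in> I"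
  shows "log_deriv i (log_deriv j f) x = log_deriv j (log_deriv i f) x"
proof (cases "i = j")
  case False
  have "log_deriv k (log_deriv l f) x = x k * x l * partial_deriv k (partial_deriv l f) x"
    if "k \<in> I" "l \<in> I" "k \<noteq> l" for k l
    using log_deriv_mult[OF C_inf_component C_inf_partial_deriv[OF f that(2)] x that(1), of l]
      log_deriv_component[OF x that(1), of l] that(3)
    by (simp add: log_deriv_def[abs_def])
  from this[OF i j False] this[OF j i] False show ?thesis
    by (simp add: partial_deriv_commute[OF C_infD[OF f] x i j])
qed simp

section \<open>The Poisson axioms for log-canonical brackets\<close>

text \<open>The Jacobi identity at one point: \<open>F\<close>, \<open>G\<close>, \<open>H\<close>
  stand for first and \<open>F'\<close>, \<open>G'\<close>, \<open>H'\<close> for second logarithmic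
  derivatives. Each cyclic term is a difference of two contractions \<open>T\<close>, and the six
  contractions cancel in pairs because \<open>T\<close> is symmetric in its outer arguments.\<close>

lemma jacobi_array:
  fixes c :: "'i \<Rightarrow> 'i \<Rightarrow> real" and F G H :: "'i \<Rightarrow> real" and F' G' H' :: "'i \<Rightarrow> 'i \<Rightarrow> real"
  assumes c: "\<And>i j. i \<in> I \<Longrightarrow> j \<in> I \<Longrightarrow> c i j = - c j i"
    and sym: "\<And>i j. i \<in> I \<Longrightarrow> j \<in> I \<Longrightarrow> F' i j = F' j i"
      "\<And>i j. i \<in> I \<Longrightarrow> j \<in> I \<Longrightarrow> G' i j = G' j i"
      "\<And>i j. i \<in> I \<Longrightarrow> j \<in> I \<Longrightarrow> H' i j = H' j i"
  shows "(\<Sum>i\<in>I. \<Sum>j\<in>I. c i j * F i * (\<Sum>k\<in>I. \<Sum>l\<in>I. c k l * (G' j k * H l + G k * H' j l)))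
    + (\<Sum>i\<in>I. \<Sum>j\<in>I. c i j * G i * (\<Sum>k\<in>I. \<Sum>l\<in>I. c k l * (H' j k * F l + H k * F' j l)))
    + (\<Sum>i\<in>I. \<Sum>j\<in>I. c i j * H i * (\<Sum>k\<in>I. \<Sum>l\<in>I. c k l * (F' j k * G l + F k * G' j l))) = 0"
proof -
  define T where "T F G' H = (\<Sum>i\<in>I. \<Sum>j\<in>I. \<Sum>k\<in>I. \<Sum>l\<in>I. c i j * c k l * F i * G' j k * H l)"
    for F H :: "'i \<Rightarrow> real" and G' :: "'i \<Rightarrow> 'i \<Rightarrow> real"
  have expand: "(\<Sum>i\<in>I. \<Sum>j\<in>I. c i j * F i *
      (\<Sum>k\<in>I. \<Sum>l\<in>I. c k l * (G' j k * H l + G k * H' j l))) = T F G' H - T F H' G"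
    for F G H :: "'i \<Rightarrow> real" and G' H' :: "'i \<Rightarrow> 'i \<Rightarrow> real"
  proof -
    have "(\<Sum>k\<in>I. \<Sum>l\<in>I. c k l * (G' j k * H l + G k * H' j l))
        = (\<Sum>k\<in>I. \<Sum>l\<in>I. c k l * G' j k * H l) - (\<Sum>k\<in>I. \<Sum>l\<in>I. c k l * H' j k * G l)" for j
    proof -
      \<comment> \<open>Exchanging \<open>k\<close> and \<open>l\<close> brings the second half into
        the shape of the first, with a sign from the antisymmetry of \<open>c\<close>.\<close>
      have "(\<Sum>k\<in>I. \<Sum>l\<in>I. c k l * G k * H' j l) = (\<Sum>l\<in>I. \<Sum>k\<in>I. c k l * G k * H' j l)"
        by (rule sum.swap)
      also have "\<dots> = (\<Sum>k\<in>I. \<Sum>l\<in>I. - (c k l * H' j k * G l))"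
        by (intro sum.cong refl) (subst c, auto)
      finally show ?thesis by (simp add: distrib_left sum.distrib sum_negf mult_ac)
    qed
    then show ?thesis
      by (simp add: T_def right_diff_distrib sum_subtractf sum_distrib_left mult_ac)
  qed
  \<comment> \<open>Reversing the order of \<open>i\<close>, \<open>j\<close>, \<open>k\<close>,
    \<open>l\<close> costs one sign for each of the two factors \<open>c\<close>, and these signs
    cancel. The symmetric array in the middle is unchanged.\<close>
  have T_sym: "T F G' H = T H G' F"
    if "\<And>i j. i \<in> I \<Longrightarrow> j \<in> I \<Longrightarrow> G' i j = G' j i" for F H G'
  proof -
    have "T F G' H = (\<Sum>l\<in>I. \<Sum>k\<in>I. \<Sum>j\<in>I. \<Sum>i\<in>I. c i j * c k l * F i * G' j k * H l)"
    proof -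
      have "T F G' H = (\<Sum>j\<in>I. \<Sum>i\<in>I. \<Sum>l\<in>I. \<Sum>k\<in>I. c i j * c k l * F i * G' j k * H l)"
        unfolding T_def by (subst sum.swap) (intro sum.cong refl sum.swap)
      also have "\<dots> = (\<Sum>j\<in>I. \<Sum>l\<in>I. \<Sum>i\<in>I. \<Sum>k\<in>I. c i j * c k l * F i * G' j k * H l)"
        by (intro sum.cong refl sum.swap)
      also have "\<dots> = (\<Sum>l\<in>I. \<Sum>j\<in>I. \<Sum>k\<in>I. \<Sum>i\<in>I. c i j * c k l * F i * G' j k * H l)"
        by (subst sum.swap) (intro sum.cong refl sum.swap)
      also have "\<dots> = (\<Sum>l\<in>I. \<Sum>k\<in>I. \<Sum>j\<in>I. \<Sum>i\<in>I. c i j * c k l * F i * G' j k * H l)"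
        by (intro sum.cong refl sum.swap)
      finally show ?thesis .
    qed
    also have "\<dots> = T H G' F"
      unfolding T_def
    proof (intro sum.cong refl)
      fix i j k l assume "i \<in> I" "j \<in> I" "k \<in> I" "l \<in> I"
      then have "c l k = - c k l" "c j i = - c i j" "G' k j = G' j k"
        by (blast intro: c that)+
      then show "c l k * c j i * F l * G' k j * H i = c i j * c k l * H i * G' j k * F l"
        by simp
    qed
    finally show ?thesis .
  qed
  show ?thesis
    unfolding expand using T_sym[OF sym(1), where F = G and H = H]
      T_sym[OF sym(2), where F = F and H = H] T_sym[OF sym(3), where F = F and H = G]
    by simp
qed

lemma log_bracket_C_inf:
  assumes "C_inf I f" "C_inf I g"
  shows "C_inf I (\<lambda>x. \<Sum>i\<in>I. \<Sum>j\<in>I. c i j * log_deriv i f x * log_deriv j g x)"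
  by (intro C_inf_sum C_inf_mult C_inf_const C_inf_log_deriv assms)

lemma log_bracket_smooth:
  assumes "f \<in> smooth_functions I" "g \<in> smooth_functions I"
  shows "log_bracket I c f g \<in> smooth_functions I"
  using assms
  by (simp add: log_bracket_def restrict_smooth_functions log_bracket_C_inf smooth_functions_C_inf)

lemma log_deriv_log_bracket:
  assumes f: "f \<in> smooth_functions I" and g: "g \<in> smooth_functions I"
    and x: "x \<in> punctured I" and m: "m \<in> I"
  shows "log_deriv m (log_bracket I c f g) x = (\<Sum>i\<in>I. \<Sum>j\<in>I. c i j *
    (log_deriv m (log_deriv i f) x * log_deriv j g x + log_deriv i f x * log_deriv m (log_deriv j g) x))"
proof -
  note sm = C_inf_log_deriv[OF smooth_functions_C_inf[OF f]]
    C_inf_log_deriv[OF smooth_functions_C_inf[OF g]]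
  have smooth: "C_inf I (\<lambda>x. c i j * log_deriv i f x * log_deriv j g x)" if "i \<in> I" "j \<in> I" for i j
    using that by (intro C_inf_mult C_inf_const sm)
  have "log_deriv m (log_bracket I c f g) x
      = log_deriv m (\<lambda>x. \<Sum>i\<in>I. \<Sum>j\<in>I. c i j * log_deriv i f x * log_deriv j g x) x"
    by (rule log_deriv_cong[OF _ x m]) (simp add: log_bracket_apply f g)
  also have "\<dots> = (\<Sum>i\<in>I. log_deriv m (\<lambda>x. \<Sum>j\<in>I. c i j * log_deriv i f x * log_deriv j g x) x)"
    by (rule log_deriv_sum[OF C_inf_sum[OF smooth] x m])
  also have "\<dots> = (\<Sum>i\<in>I. \<Sum>j\<in>I. log_deriv m (\<lambda>x. c i j * log_deriv i f x * log_deriv j g x) x)"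
    by (rule sum.cong[OF refl]) (rule log_deriv_sum[OF smooth x m])
  also have "\<dots> = (\<Sum>i\<in>I. \<Sum>j\<in>I. c i j *
    (log_deriv m (log_deriv i f) x * log_deriv j g x + log_deriv i f x * log_deriv m (log_deriv j g) x))"
  proof (intro sum.cong refl)
    fix i j assume "i \<in> I" "j \<in> I"
    then show "log_deriv m (\<lambda>x. c i j * log_deriv i f x * log_deriv j g x) x = c i j *
       (log_deriv m (log_deriv i f) x * log_deriv j g x
         + log_deriv i f x * log_deriv m (log_deriv j g) x)"
      using log_deriv_mult[OF C_inf_mult[OF C_inf_const sm(1)] sm(2) x m, of i j "c i j"]
        log_deriv_lincomb[OF sm(1) sm(1) x m, of i i "c i j" 0]
      by (simp add: algebra_simps)
  qed
  finally show ?thesis .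
qed

lemma poisson_bracket_log_bracket:
  assumes c: "\<And>i j. i \<in> I \<Longrightarrow> j \<in> I \<Longrightarrow> c i j = - c j i"
  shows "poisson_bracket I (log_bracket I c)"
  unfolding poisson_bracket_def
proof (intro conjI ballI allI)
  show "log_bracket I c \<in> smooth_functions I \<rightarrow>\<^sub>E (smooth_functions I \<rightarrow>\<^sub>E smooth_functions I)"
  proof (intro PiE_I)
    show "log_bracket I c f g \<in> smooth_functions I"
      if "f \<in> smooth_functions I" "g \<in> smooth_functions I" for f g
      using that by (rule log_bracket_smooth)
  qed (auto simp: log_bracket_def)
next
  fix f g assume fg: "f \<in> smooth_functions I" "g \<in> smooth_functions I"
  show "log_bracket I c f g = (\<lambda>x\<in>punctured I. - log_bracket I c g f x)"
  proof
    fix x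
    show "log_bracket I c f g x = (\<lambda>x\<in>punctured I. - log_bracket I c g f x) x"
    proof (cases "x \<in> punctured I")
      case True
      have "(\<Sum>i\<in>I. \<Sum>j\<in>I. c i j * log_deriv i f x * log_deriv j g x)
          = (\<Sum>j\<in>I. \<Sum>i\<in>I. c i j * log_deriv i f x * log_deriv j g x)"
        by (rule sum.swap)
      also have "\<dots> = (\<Sum>j\<in>I. \<Sum>i\<in>I. - (c j i * log_deriv j g x * log_deriv i f x))"
        by (intro sum.cong refl) (subst c, auto)
      finally show ?thesis using True fg by (simp add: log_bracket_apply sum_negf)
    qed (use fg in \<open>simp add: log_bracket_def\<close>)
  qed
next
  fix f g h and p q :: real
  assume fgh: "f \<in> smooth_functions I" "g \<in> smooth_functions I" "h \<in> smooth_functions I"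
  note sm = fgh[THEN smooth_functions_C_inf]
  let ?l = "\<lambda>x\<in>punctured I. p * f x + q * g x"
  have l: "?l \<in> smooth_functions I"
    by (intro restrict_smooth_functions C_inf_add C_inf_cmult sm)
  show "log_bracket I c ?l h
      = (\<lambda>x\<in>punctured I. p * log_bracket I c f h x + q * log_bracket I c g h x)"
  proof
    fix x
    show "log_bracket I c ?l h x
      = (\<lambda>x\<in>punctured I. p * log_bracket I c f h x + q * log_bracket I c g h x) x"
    proof (cases "x \<in> punctured I")
      case True
      have "log_deriv i ?l x = p * log_deriv i f x + q * log_deriv i g x" if "i \<in> I" for i
        using log_deriv_cong[of I ?l "\<lambda>x. p * f x + q * g x", OF _ True that]
          log_deriv_lincomb[OF sm(1,2) True that] by simp
      then show ?thesis using True fgh l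
        by (simp add: log_bracket_apply sum_distrib_left flip: sum.distrib)
          (intro sum.cong refl, simp add: algebra_simps)
    qed (use fgh l in \<open>simp add: log_bracket_def\<close>)
  qed
next
  fix f g h
  assume fgh: "f \<in> smooth_functions I" "g \<in> smooth_functions I" "h \<in> smooth_functions I"
  note sm = fgh[THEN smooth_functions_C_inf]
  let ?l = "\<lambda>x\<in>punctured I. f x * g x"
  have l: "?l \<in> smooth_functions I"
    by (intro restrict_smooth_functions C_inf_mult sm)
  show "log_bracket I c ?l h
      = (\<lambda>x\<in>punctured I. f x * log_bracket I c g h x + log_bracket I c f h x * g x)"
  proof
    fix x
    show "log_bracket I c ?l h x
      = (\<lambda>x\<in>punctured I. f x * log_bracket I c g h x + log_bracket I c f h x * g x) x"
    proof (cases "x \<in> punctured I")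
      case True
      have "log_deriv i ?l x = f x * log_deriv i g x + log_deriv i f x * g x" if "i \<in> I" for i
        using log_deriv_cong[of I ?l "\<lambda>x. f x * g x", OF _ True that]
          log_deriv_mult[OF sm(1,2) True that] by simp
      then show ?thesis using True fgh l
        by (simp add: log_bracket_apply sum_distrib_left sum_distrib_right flip: sum.distrib)
          (intro sum.cong refl, simp add: algebra_simps)
    qed (use fgh l in \<open>simp add: log_bracket_def\<close>)
  qed
next
  fix f g h x
  assume fgh: "f \<in> smooth_functions I" "g \<in> smooth_functions I" "h \<in> smooth_functions I"
    and x: "x \<in> punctured I"
  note sm = fgh[THEN smooth_functions_C_inf]
  show "log_bracket I c f (log_bracket I c g h) x + log_bracket I c g (log_bracket I c h f) x
      + log_bracket I c h (log_bracket I c f g) x = 0"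
    \<comment> \<open>By \<open>log_deriv_log_bracket\<close>, a nested bracket at \<open>x\<close>
      involves only first and second logarithmic derivatives there, and the second ones are
      symmetric.\<close>
    using jacobi_array[where F = "\<lambda>i. log_deriv i f x" and F' = "\<lambda>i j. log_deriv i (log_deriv j f) x"
        and G = "\<lambda>i. log_deriv i g x" and G' = "\<lambda>i j. log_deriv i (log_deriv j g) x"
        and H = "\<lambda>i. log_deriv i h x" and H' = "\<lambda>i j. log_deriv i (log_deriv j h) x", OF c log_deriv_commute[OF sm(1) x] log_deriv_commute[OF sm(2) x]
        log_deriv_commute[OF sm(3) x]] fgh x
    by (simp add: log_bracket_apply log_bracket_smooth log_deriv_log_bracket)
qed

lemma log_bracket_coord:
  assumes "finite I" "i \<in> I" "j \<in> I"
  shows "log_bracket I c (coord I i) (coord I j) = (\<lambda>x\<in>punctured I. c i j * x i * x j)"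
proof
  fix x
  show "log_bracket I c (coord I i) (coord I j) x = (\<lambda>x\<in>punctured I. c i j * x i * x j) x"
  proof (cases "x \<in> punctured I")
    case True
    have "log_deriv k (coord I l) x = (if k = l then x k else 0)" if "k \<in> I" for k l
      using partial_deriv_coord[OF True that, of l] by (simp add: log_deriv_def)
    with True assms show ?thesis
      by (simp add: log_bracket_apply coord_smooth_functions if_distrib[of "\<lambda>t. _ * t"]
          if_distrib[of "\<lambda>t. t * _"] cong: if_cong)
  qed (simp add: log_bracket_def coord_smooth_functions)
qed

text \<open>On smooth arguments both sides have the same coordinate expansion; elsewhere both are
  \<open>undefined\<close> by extensionality.\<close>

lemma poisson_bracket_eq_log_bracket:
  assumes B: "poisson_bracket I B" and I: "finite I"
    and c: "\<And>i j. i \<in> I \<Longrightarrow> j \<in> I \<Longrightarrow>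
      B (coord I i) (coord I j) = (\<lambda>x\<in>punctured I. c i j * x i * x j)"
  shows "B = log_bracket I c"
proof (intro ext)
  fix f g x
  note fs = poisson_bracket_funcset[OF B]
  consider "f \<notin> smooth_functions I" | "f \<in> smooth_functions I" "g \<notin> smooth_functions I"
    | "f \<in> smooth_functions I" "g \<in> smooth_functions I" "x \<notin> punctured I"
    | "f \<in> smooth_functions I" "g \<in> smooth_functions I" "x \<in> punctured I" by blast
  then show "B f g x = log_bracket I c f g x"
  proof cases
    case 1
    have "B f = undefined" by (rule PiE_arb[OF fs 1])
    with 1 show ?thesis by (simp add: log_bracket_def)
  next
    case 2
    have "B f g = undefined" by (rule PiE_arb[OF PiE_mem[OF fs 2(1)] 2(2)])
    with 2 show ?thesis by (simp add: log_bracket_def)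
  next
    case 3
    have "B f g \<in> smooth_functions I" by (rule PiE_mem[OF PiE_mem[OF fs 3(1)] 3(2)])
    then have "B f g x = undefined" using 3(3) by (simp add: smooth_functions_iff extensional_def)
    with 3 show ?thesis by (simp add: log_bracket_def)
  next
    case 4
    have "B f g x = (\<Sum>i\<in>I. \<Sum>j\<in>I. partial_deriv i f x * partial_deriv j g x
        * B (coord I i) (coord I j) x)"
      by (rule poisson_bracket_expansion[OF B I 4(3,1,2)])
    also have "\<dots> = (\<Sum>i\<in>I. \<Sum>j\<in>I. c i j * log_deriv i f x * log_deriv j g x)"
      by (intro sum.cong refl) (simp add: c 4(3) log_deriv_def)
    finally show ?thesis by (simp only: log_bracket_apply[OF 4])
  qed
qed

section \<open>Quadratic brackets in three coordinates\<close>

text \<open>\<open>antisymmetric_coeffs\<close> and \<open>quadratic_relations\<close> constrain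
  only entries off the diagonal. A zero diagonal makes the whole array antisymmetric, as
  \<open>poisson_bracket_log_bracket\<close> asks.\<close>

definition offdiag :: "(nat \<Rightarrow> nat \<Rightarrow> real) \<Rightarrow> nat \<Rightarrow> nat \<Rightarrow> real" where
  "offdiag \<alpha> i j = (if i = j then 0 else \<alpha> i j)"

lemma offdiag_antisym:
  assumes "antisymmetric_coeffs \<alpha>" "i \<in> {1, 2, 3}" "j \<in> {1, 2, 3}"
  shows "offdiag \<alpha> i j = - offdiag \<alpha> j i"
proof (cases "i = j")
  case False
  with assms have "\<alpha> i j = - \<alpha> j i" unfolding antisymmetric_coeffs_def by blast
  with False show ?thesis by (simp add: offdiag_def)
qed (simp add: offdiag_def)

lemma poisson_bracket_offdiag:
  "antisymmetric_coeffs \<alpha> \<Longrightarrow> poisson_bracket {1, 2, 3} (log_bracket {1, 2, 3} (offdiag \<alpha>))"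
  by (intro poisson_bracket_log_bracket offdiag_antisym)

text \<open>At this point a bracket \<open>c * x i * x j\<close> takes the value \<open>c\<close>,
  so coefficients can be read off there.\<close>

lemma ones_punctured: "(\<lambda>i\<in>I. 1) \<in> punctured I"
  by (simp add: punctured_def PiE_iff)

lemma quadratic_relations_log_bracket: "quadratic_relations \<alpha> (log_bracket {1, 2, 3} (offdiag \<alpha>))"
  unfolding quadratic_relations_def
  by (intro ballI impI, subst log_bracket_coord) (auto simp: offdiag_def)

text \<open>The relations give the brackets of distinct coordinates, and antisymmetry makes the
  bracket of a coordinate with itself vanish. Coordinate brackets determine the whole
  bracket.\<close>

lemma quadratic_relations_imp_log_bracket:
  assumes B: "poisson_bracket {1, 2, 3} B" and q: "quadratic_relations \<alpha> B"
  shows "B = log_bracket {1, 2, 3} (offdiag \<alpha>)"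
proof (rule poisson_bracket_eq_log_bracket[OF B])
  fix i j :: nat assume ij: "i \<in> {1, 2, 3}" "j \<in> {1, 2, 3}"
  let ?c = "coord {1, 2, 3 :: nat}"
  show "B (?c i) (?c j) = (\<lambda>x\<in>punctured {1, 2, 3}. offdiag \<alpha> i j * x i * x j)"
  proof (cases "i = j")
    case True
    have "B (?c i) (?c i) = (\<lambda>x\<in>punctured {1, 2, 3}. - B (?c i) (?c i) x)"
      by (rule poisson_bracket_antisym[OF B coord_smooth_functions coord_smooth_functions])
    then have eq: "B (?c i) (?c i) x = (\<lambda>x\<in>punctured {1, 2, 3}. - B (?c i) (?c i) x) x" for x
      by (rule fun_cong)
    have "B (?c i) (?c i) x = (\<lambda>x\<in>punctured {1, 2, 3}. 0) x" for x
      using eq[of x] by (cases "x \<in> punctured {1, 2, 3}") auto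
    then show ?thesis by (simp add: True offdiag_def fun_eq_iff cong: restrict_cong)
  next
    case False
    then have "B (?c i) (?c j) = (\<lambda>x\<in>punctured {1, 2, 3}. \<alpha> i j * x i * x j)"
      using q ij unfolding quadratic_relations_def by blast
    with False show ?thesis by (simp add: offdiag_def)
  qed
qed simp

lemma quadratic_relations_unique:
  assumes "quadratic_relations \<alpha> B" "quadratic_relations \<alpha>' B" "i \<in> {1, 2, 3}" "j \<in> {1, 2, 3}" "i \<noteq> j"
  shows "\<alpha> i j = \<alpha>' i j"
proof -
  have "B (coord {1, 2, 3} i) (coord {1, 2, 3} j) = (\<lambda>x\<in>punctured {1, 2, 3}. \<alpha> i j * x i * x j)"
    and "B (coord {1, 2, 3} i) (coord {1, 2, 3} j) = (\<lambda>x\<in>punctured {1, 2, 3}. \<alpha>' i j * x i * x j)"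
    using assms unfolding quadratic_relations_def by blast+
  from fun_cong[OF trans[OF sym[OF this(1)] this(2)], of "\<lambda>i\<in>{1, 2, 3}. 1"] show ?thesis
    using assms ones_punctured[of "{1, 2, 3 :: nat}"] by auto
qed

lemma quadratic_relations_antisymmetric:
  assumes B: "poisson_bracket {1, 2, 3} B" and q: "quadratic_relations \<alpha> B"
  shows "antisymmetric_coeffs \<alpha>"
  unfolding antisymmetric_coeffs_def
proof (intro ballI impI)
  fix i j :: nat assume ij: "i \<in> {1, 2, 3}" "j \<in> {1, 2, 3}" "i \<noteq> j"
  let ?c = "coord {1, 2, 3 :: nat}" and ?o = "\<lambda>i\<in>{1, 2, 3 :: nat}. 1 :: real"
  have val: "B (?c i) (?c j) ?o = \<alpha> i j"
    if "i \<in> {1, 2, 3}" "j \<in> {1, 2, 3}" "i \<noteq> j" for i j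
  proof -
    have "B (?c i) (?c j) = (\<lambda>x\<in>punctured {1, 2, 3}. \<alpha> i j * x i * x j)"
      using q that unfolding quadratic_relations_def by blast
    then have "B (?c i) (?c j) ?o = \<alpha> i j * ?o i * ?o j"
      using ones_punctured[of "{1, 2, 3 :: nat}"] by simp
    with that show ?thesis by simp
  qed
  have "B (?c i) (?c j) ?o = - B (?c j) (?c i) ?o"
    using fun_cong[OF poisson_bracket_antisym[OF B coord_smooth_functions coord_smooth_functions], of i j ?o]
      ones_punctured[of "{1, 2, 3 :: nat}"] by simp
  then show "\<alpha> i j = - \<alpha> j i" using val[of i j] val[of j i] ij by simp
qed

section \<open>The network\<close>

locale labelled_network =
  fixes G :: "('v, 'e) pre_digraph" and n :: nat and b :: "nat \<Rightarrow> 'v" and lab :: "'v \<Rightarrow> 'e \<Rightarrow> nat"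
  assumes network: "disk_network G n b" and labelling: "flag_labelling G n b lab"
begin

sublocale digraph G
  using network by (simp add: disk_network_def)

abbreviation "inner_verts \<equiv> internal G n b"
abbreviation "flags \<equiv> flag_coords G n b"
abbreviation "wt \<equiv> weight_map G lab"

section \<open>Incidences, flag labels and edge weights\<close>

definition inc :: "'v \<Rightarrow> 'e set" where
  "inc v = in_arcs G v \<union> out_arcs G v"

definition opp :: "'v \<Rightarrow> 'e \<Rightarrow> 'v" where
  "opp v e = (if tail G e = v then head G e else tail G e)"

text \<open>The factor of the weight of \<open>e\<close> that belongs to the other endpoint; it is a
  constant for the bracket at \<open>v\<close>.\<close>

definition opp_coord :: "('v \<times> nat \<Rightarrow> real) \<Rightarrow> 'v \<Rightarrow> 'e \<Rightarrow> real" where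
  "opp_coord x v e = x (opp v e, lab (opp v e) e)"

lemma inc_iff: "e \<in> inc v \<longleftrightarrow> e \<in> arcs G \<and> (tail G e = v \<or> head G e = v)"
  by (auto simp: inc_def)

lemma finite_inc: "finite (inc v)"
  by (rule finite_subset[OF _ finite_arcs]) (auto simp: inc_iff)

lemma finite_inner: "finite inner_verts"
  by (simp add: internal_def)

lemma opp:
  assumes "e \<in> inc v"
  shows "opp v e \<noteq> v" "opp v e \<in> verts G" "e \<in> inc (opp v e)"
  using assms no_loops[of e] by (auto simp: opp_def inc_iff)

lemma inner_or_boundary: "v \<in> verts G \<Longrightarrow> v \<in> inner_verts \<or> v \<in> boundary n b"
  by (auto simp: internal_def)

lemma lab_bij: "v \<in> inner_verts \<Longrightarrow> bij_betw (lab v) (inc v) {1, 2, 3}"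
  using labelling by (auto simp: flag_labelling_def inc_def)

text \<open>At an inner vertex the labelling is a bijection; at a boundary vertex there is only one
  incident edge.\<close>

lemma inj_lab:
  assumes "v \<in> verts G"
  shows "inj_on (lab v) (inc v)"
  using inner_or_boundary[OF assms]
proof
  assume "v \<in> inner_verts"
  then show ?thesis using lab_bij bij_betw_imp_inj_on by blast
next
  assume "v \<in> boundary n b"
  then have "source G v \<or> sink G v" using network by (simp add: disk_network_def)
  moreover have "finite (in_arcs G v)" "finite (out_arcs G v)"
    by (auto intro: finite_subset[OF _ finite_arcs])
  ultimately have "\<exists>e. inc v = {e}"
    unfolding source_def sink_def in_degree_def out_degree_def inc_def
    by (auto simp: card_1_singleton_iff)
  then show ?thesis by auto
qed

lemma lab_flag:
  assumes "e \<in> inc v"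
  shows "(v, lab v e) \<in> flags"
proof -
  have "v \<in> verts G" using assms by (auto simp: inc_iff)
  from inner_or_boundary[OF this] show ?thesis
  proof
    assume v: "v \<in> inner_verts"
    then have "lab v e \<in> {1, 2, 3}" using lab_bij[OF v] assms by (auto simp: bij_betw_def)
    with v show ?thesis by (simp add: flag_coords_def)
  next
    assume v: "v \<in> boundary n b"
    then have "lab v e = 1"
      using labelling assms unfolding flag_labelling_def inc_def by blast
    with v show ?thesis by (simp add: flag_coords_def)
  qed
qed

lemma opp_coord_nonzero: "x \<in> punctured flags \<Longrightarrow> e \<in> inc v \<Longrightarrow> opp_coord x v e \<noteq> 0"
  unfolding opp_coord_def by (intro punctured_nonzero[of x flags] lab_flag opp)

lemma weight_map_inc:
  "e \<in> inc v \<Longrightarrow> wt x e = opp_coord x v e * x (v, lab v e)"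
  by (auto simp: weight_map_def inc_iff opp_coord_def opp_def)

lemma weight_map_punctured:
  assumes "x \<in> punctured flags"
  shows "wt x \<in> punctured (arcs G)"
proof -
  have "wt x e \<noteq> 0" if "e \<in> arcs G" for e
  proof -
    have e: "e \<in> inc (tail G e)" using that by (simp add: inc_iff)
    show ?thesis
      unfolding weight_map_inc[OF e]
      using opp_coord_nonzero[OF assms e] punctured_nonzero[OF assms lab_flag[OF e]] by simp
  qed
  then show ?thesis by (simp add: punctured_def PiE_iff weight_map_def)
qed

text \<open>Both edges have the endpoint set \<open>{u, v}\<close>, and there are neither parallel
  nor antiparallel edges. Consequently the bracket of two distinct edge weights receives a
  contribution from at most one vertex.\<close>

lemma inc_inc_eq:
  assumes "e \<in> inc u" "e \<in> inc v" "e' \<in> inc u" "e' \<in> inc v" "u \<noteq> v"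
  shows "e = e'"
proof -
  have inj: "inj_on (\<lambda>e. {tail G e, head G e}) (arcs G)"
    using network by (simp add: disk_network_def)
  have "{tail G e, head G e} = {u, v}" "{tail G e', head G e'} = {u, v}"
    using assms by (auto simp: inc_iff)
  then show ?thesis using inj_onD[OF inj, of e e'] assms by (auto simp: inc_iff)
qed

section \<open>Edge weights as functions of the coordinates at one vertex\<close>

lemma vertex_part_punctured:
  "x \<in> punctured flags \<Longrightarrow> v \<in> inner_verts \<Longrightarrow> vertex_part v x \<in> punctured {1, 2, 3}"
  by (auto simp: vertex_part_def punctured_def PiE_iff flag_coords_def)

lemma replace_part_punctured:
  assumes "x \<in> punctured flags" "v \<in> inner_verts" "y \<in> punctured {1, 2, 3}"
  shows "replace_part v x y \<in> punctured flags"
proof -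
  have v: "i \<in> {1, 2, 3}" if "(v, i) \<in> flags" for i
    using that assms(2) by (auto simp: flag_coords_def internal_def)
  have "replace_part v x y p \<noteq> 0" if "p \<in> flags" for p
    using that v punctured_nonzero[OF assms(1)] punctured_nonzero[OF assms(3)]
    by (cases p) (auto simp: replace_part_def)
  moreover have "replace_part v x y p = undefined" if "p \<notin> flags" for p
    using that assms by (cases p)
      (auto simp: replace_part_def punctured_def PiE_iff extensional_def flag_coords_def)
  ultimately show ?thesis by (auto simp: punctured_def PiE_iff extensional_def)
qed

text \<open>With all other coordinates frozen at \<open>x\<close>, the weight of an edge at
  \<open>v\<close> is a nonzero multiple of one coordinate at \<open>v\<close> when \<open>x\<close>
  is in the punctured space, and every other weight is constant.\<close>

definition vertex_subst :: "('v \<times> nat \<Rightarrow> real) \<Rightarrow> 'v \<Rightarrow> (nat \<Rightarrow> real) \<Rightarrow> 'e \<Rightarrow> real" where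
  "vertex_subst x v = coord_subst (arcs G) (inc v) (lab v) (opp_coord x v) (wt x)"

lemma weight_map_replace_part: "wt (replace_part v x y) = vertex_subst x v y"
proof
  fix e
  show "wt (replace_part v x y) e = vertex_subst x v y e"
  proof (cases "e \<in> inc v")
    case True
    then have "opp_coord (replace_part v x y) v e = opp_coord x v e"
      using opp(1)[OF True] by (simp add: opp_coord_def replace_part_def)
    with True show ?thesis
      unfolding weight_map_inc[OF True]
      by (simp add: vertex_subst_def coord_subst_def replace_part_def inc_iff)
  qed (auto simp: vertex_subst_def coord_subst_def inc_iff weight_map_def replace_part_def)
qed

lemma vertex_subst_vertex_part: "v \<in> inner_verts \<Longrightarrow> vertex_subst x v (vertex_part v x) = wt x"
proof -
  assume v: "v \<in> inner_verts"
  have "lab v e \<in> {1, 2, 3}" if "e \<in> inc v" for e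
    using lab_bij[OF v] that by (auto simp: bij_betw_def)
  then have "vertex_subst x v (vertex_part v x) e = wt x e" for e
    using weight_map_inc[of e v x]
    by (auto simp: vertex_subst_def coord_subst_def vertex_part_def inc_iff weight_map_def)
  then show ?thesis by blast
qed

lemma slice_compose:
  assumes "x \<in> punctured flags" "v \<in> inner_verts"
  shows "slice v x (compose (punctured flags) f wt)
    = (\<lambda>y\<in>punctured {1, 2, 3}. f (vertex_subst x v y))"
  unfolding slice_def using replace_part_punctured[OF assms]
  by (intro restrict_ext) (simp add: compose_def weight_map_replace_part)

context
  fixes x v assumes x: "x \<in> punctured flags" and v: "v \<in> inner_verts"
begin

lemma vertex_subst_conditions:
  shows "inc v \<subseteq> arcs G" "inj_on (lab v) (inc v)" "lab v ` inc v \<subseteq> {1, 2, 3}"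
    "\<And>e. e \<in> inc v \<Longrightarrow> opp_coord x v e \<noteq> 0" "\<And>e. e \<in> arcs G - inc v \<Longrightarrow> wt x e \<noteq> 0"
  using lab_bij[OF v] opp_coord_nonzero[OF x] punctured_nonzero[OF weight_map_punctured[OF x]]
  by (auto simp: inc_iff bij_betw_def)

lemma slice_smooth:
  assumes "f \<in> smooth_functions (arcs G)"
  shows "slice v x (compose (punctured flags) f wt) \<in> smooth_functions {1, 2, 3}"
  unfolding slice_compose[OF x v] vertex_subst_def
  by (intro restrict_smooth_functions C_inf_def[THEN iffD2] allI
      C_diff_coord_subst[OF vertex_subst_conditions] C_infD[OF smooth_functions_C_inf[OF assms]])

lemma partial_deriv_slice:
  assumes f: "f \<in> smooth_functions (arcs G)" and e: "e \<in> inc v"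
  shows "partial_deriv (lab v e) (slice v x (compose (punctured flags) f wt)) (vertex_part v x)
    = opp_coord x v e * partial_deriv e f (wt x)"
proof -
  note vp = vertex_part_punctured[OF x v]
  have "partial_deriv (lab v e) (slice v x (compose (punctured flags) f wt)) (vertex_part v x)
      = partial_deriv (lab v e) (\<lambda>y. f (vertex_subst x v y)) (vertex_part v x)"
    unfolding slice_compose[OF x v]
    by (rule partial_deriv_cong[OF _ vp]) (use e vertex_subst_conditions(3) in auto)
  also have "\<dots> = opp_coord x v e * partial_deriv e f (wt x)"
    using partial_deriv_coord_subst[OF vertex_subst_conditions
        C_infD[OF smooth_functions_C_inf[OF f]] vp e] vertex_subst_vertex_part[OF v]
    by (simp add: vertex_subst_def)
  finally show ?thesis .
qed

end

section \<open>Brackets of functions pulled back along the weight map\<close>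

text \<open>The chain rule in the form of \<open>partial_deriv_slice\<close>, with sums over the
  three coordinates at \<open>v\<close> reindexed by its edges along \<open>lab v\<close>. Necessity
  evaluates this formula on coordinate functions; sufficiency compares it with a log-canonical
  bracket of weights.\<close>

lemma sum_bracket_expansion:
  assumes br: "br \<in> vertex_brackets G n b" and x: "x \<in> punctured flags"
    and f: "f \<in> smooth_functions (arcs G)" and g: "g \<in> smooth_functions (arcs G)"
  shows "sum_bracket G n b br (compose (punctured flags) f wt) (compose (punctured flags) g wt) x
    = (\<Sum>v\<in>inner_verts. \<Sum>e\<in>inc v. \<Sum>e'\<in>inc v.
        (opp_coord x v e * partial_deriv e f (wt x)) * (opp_coord x v e' * partial_deriv e' g (wt x))
        * br v (coord {1, 2, 3} (lab v e)) (coord {1, 2, 3} (lab v e')) (vertex_part v x))"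
proof -
  have "br v (slice v x (compose (punctured flags) f wt)) (slice v x (compose (punctured flags) g wt))
      (vertex_part v x) = (\<Sum>e\<in>inc v. \<Sum>e'\<in>inc v.
        (opp_coord x v e * partial_deriv e f (wt x)) * (opp_coord x v e' * partial_deriv e' g (wt x))
        * br v (coord {1, 2, 3} (lab v e)) (coord {1, 2, 3} (lab v e')) (vertex_part v x))"
    if v: "v \<in> inner_verts" for v
  proof -
    let ?f = "slice v x (compose (punctured flags) f wt)"
    let ?g = "slice v x (compose (punctured flags) g wt)"
    let ?y = "vertex_part v x"
    have B: "poisson_bracket {1, 2, 3} (br v)"
      using br v by (auto simp: vertex_brackets_def)
    have "br v ?f ?g ?y = (\<Sum>i\<in>{1, 2, 3}. \<Sum>j\<in>{1, 2, 3}. partial_deriv i ?f ?y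
        * partial_deriv j ?g ?y * br v (coord {1, 2, 3} i) (coord {1, 2, 3} j) ?y)"
      by (rule poisson_bracket_expansion[OF B _ vertex_part_punctured[OF x v]
            slice_smooth[OF x v f] slice_smooth[OF x v g]]) simp
    also have "\<dots> = (\<Sum>e\<in>inc v. \<Sum>e'\<in>inc v. partial_deriv (lab v e) ?f ?y
        * partial_deriv (lab v e') ?g ?y * br v (coord {1, 2, 3} (lab v e)) (coord {1, 2, 3} (lab v e')) ?y)"
      unfolding sum.reindex_bij_betw[OF lab_bij[OF v], symmetric] ..
    finally show ?thesis
      by (simp add: partial_deriv_slice[OF x v f] partial_deriv_slice[OF x v g] cong: sum.cong)
  qed
  then show ?thesis using x by (simp add: sum_bracket_def)
qed

text \<open>The partial derivatives of the two coordinate functions select the pair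
  \<open>e\<close>, \<open>e'\<close>, and \<open>v\<close> is the only vertex incident with both
  edges.\<close>

lemma sum_bracket_coord:
  assumes br: "br \<in> vertex_brackets G n b" and x: "x \<in> punctured flags" and v: "v \<in> inner_verts"
    and e: "e \<in> inc v" "e' \<in> inc v" "e \<noteq> e'"
  shows "sum_bracket G n b br (compose (punctured flags) (coord (arcs G) e) wt)
      (compose (punctured flags) (coord (arcs G) e') wt) x
    = opp_coord x v e * opp_coord x v e'
      * br v (coord {1, 2, 3} (lab v e)) (coord {1, 2, 3} (lab v e')) (vertex_part v x)"
proof -
  let ?Q = "\<lambda>u a a'. br u (coord {1, 2, 3} (lab u a)) (coord {1, 2, 3} (lab u a')) (vertex_part u x)"
  let ?T = "\<lambda>u a a'. opp_coord x u a * opp_coord x u a' * ?Q u a a'"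
  have pd: "partial_deriv a (coord (arcs G) d) (wt x) = (if a = d then 1 else 0)"
    if "a \<in> inc u" for a d u
    using that by (intro partial_deriv_coord weight_map_punctured x) (simp add: inc_iff)
  have "(\<Sum>a\<in>inc u. \<Sum>a'\<in>inc u. (opp_coord x u a * partial_deriv a (coord (arcs G) e) (wt x))
        * (opp_coord x u a' * partial_deriv a' (coord (arcs G) e') (wt x)) * ?Q u a a')
      = (if u = v then ?T v e e' else 0)" for u
  proof -
    have "(\<Sum>a\<in>inc u. \<Sum>a'\<in>inc u. (opp_coord x u a * partial_deriv a (coord (arcs G) e) (wt x))
        * (opp_coord x u a' * partial_deriv a' (coord (arcs G) e') (wt x)) * ?Q u a a')
      = (\<Sum>a\<in>inc u. if a = e then \<Sum>a'\<in>inc u. if a' = e' then ?T u a a' else 0 else 0)"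
      by (intro sum.cong refl) (auto simp: pd intro!: sum.cong)
    also have "\<dots> = (if e \<in> inc u \<and> e' \<in> inc u then ?T u e e' else 0)"
      by (simp add: finite_inc)
    also have "\<dots> = (if u = v then ?T v e e' else 0)"
      using e inc_inc_eq[of e u v e'] by auto
    finally show ?thesis .
  qed
  then show ?thesis
    using v by (simp add: sum_bracket_expansion[OF br x coord_smooth_functions coord_smooth_functions]
        finite_inner)
qed

section \<open>Fibres of the weight map and necessity of the quadratic relations\<close>

text \<open>
  A point with prescribed coordinates at \<open>v\<close> and all edge weights equal to \<open>1\<close>. The product has
  a single factor if \<open>(u, k)\<close> is a flag of an edge joining \<open>u\<close> to \<open>v\<close>, and is empty otherwise.
\<close>

definition balanced_point :: "'v \<Rightarrow> (nat \<Rightarrow> real) \<Rightarrow> 'v \<times> nat \<Rightarrow> real" where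
  "balanced_point v y = (\<lambda>(u, k)\<in>flags. if u = v then y k
     else 1 / (\<Prod>a | a \<in> inc v \<and> a \<in> inc u \<and> lab u a = k. y (lab v a)))"

context
  fixes v and y :: "nat \<Rightarrow> real" assumes v: "v \<in> inner_verts" and y: "y \<in> punctured {1, 2, 3}"
begin

lemma y_lab_nonzero: "a \<in> inc v \<Longrightarrow> y (lab v a) \<noteq> 0"
  using lab_bij[OF v] by (intro punctured_nonzero[OF y]) (auto simp: bij_betw_def)

lemma balanced_point_punctured: "balanced_point v y \<in> punctured flags"
proof -
  have "balanced_point v y p \<noteq> 0" if p: "p \<in> flags" for p
  proof -
    obtain u k where [simp]: "p = (u, k)" by fastforce
    have "y k \<noteq> 0" if "u = v"
      using p v that by (intro punctured_nonzero[OF y]) (auto simp: flag_coords_def internal_def)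
    then show ?thesis using p y_lab_nonzero
      by (auto simp: balanced_point_def finite_inc)
  qed
  then show ?thesis by (simp add: punctured_def PiE_iff balanced_point_def)
qed

lemma vertex_part_balanced_point: "vertex_part v (balanced_point v y) = y"
proof
  fix i
  show "vertex_part v (balanced_point v y) i = y i"
    using v y by (cases "i \<in> {1, 2, 3}")
      (auto simp: vertex_part_def balanced_point_def flag_coords_def punctured_def PiE_iff extensional_def)
qed

text \<open>Labels at the other endpoint are injective, so the product has \<open>e\<close> as its
  only index.\<close>

lemma balanced_point_opp:
  assumes e: "e \<in> inc v"
  shows "opp_coord (balanced_point v y) v e = 1 / y (lab v e)"
proof -
  let ?u = "opp v e"
  have "{a. a \<in> inc v \<and> a \<in> inc ?u \<and> lab ?u a = lab ?u e} = {e}"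
    using inj_onD[OF inj_lab[OF opp(2)[OF e]]] opp(3)[OF e] e by auto
  then show ?thesis
    using opp(1)[OF e] lab_flag[OF opp(3)[OF e]] by (simp add: opp_coord_def balanced_point_def)
qed

text \<open>For an edge at \<open>v\<close> the two factors are mutually inverse. For any other edge
  both factors come from empty products, by injectivity of the labels.\<close>

lemma weight_map_balanced_point: "wt (balanced_point v y) = (\<lambda>e\<in>arcs G. 1)"
proof
  fix e
  consider "e \<in> inc v" | "e \<in> arcs G" "e \<notin> inc v" | "e \<notin> arcs G" by blast
  then show "wt (balanced_point v y) e = (\<lambda>e\<in>arcs G. 1) e"
  proof cases
    case 1
    then have "balanced_point v y (v, lab v e) = y (lab v e)"
      using lab_flag[OF 1] by (simp add: balanced_point_def)
    with 1 show ?thesis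
      using y_lab_nonzero[OF 1] by (simp add: weight_map_inc[OF 1] balanced_point_opp[OF 1] inc_iff)
  next
    case 2
    have "balanced_point v y (u, lab u e) = 1" if u: "e \<in> inc u" for u
    proof -
      have "u \<in> verts G" using u by (auto simp: inc_iff)
      then have empty: "{a. a \<in> inc v \<and> a \<in> inc u \<and> lab u a = lab u e} = {}"
        using inj_onD[OF inj_lab, of u _ e] u 2(2) by auto
      have "u \<noteq> v" using u 2 by auto
      then show ?thesis using lab_flag[OF u] unfolding balanced_point_def by (simp add: empty)
    qed
    with 2 show ?thesis by (simp add: weight_map_def inc_iff)
  qed (simp add: weight_map_def)
qed

end

text \<open>Every \<open>y\<close> occurs as the \<open>v\<close>-part of a balanced point, and all
  these points have the same image under the weight map. The value there of the bracket on weights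
  is therefore independent of \<open>y\<close>, and it equals the bracket of the coordinates at
  \<open>y\<close> divided by \<open>y i * y j\<close>.\<close>

lemma weight_map_poisson_imp_quadratic:
  assumes br: "br \<in> vertex_brackets G n b" and P: "weight_map_poisson G n b lab br" and v: "v \<in> inner_verts"
  shows "\<exists>\<alpha>. quadratic_relations \<alpha> (br v)"
proof -
  from P obtain P where P: "\<And>f g. f \<in> smooth_functions (arcs G) \<Longrightarrow> g \<in> smooth_functions (arcs G) \<Longrightarrow>
      sum_bracket G n b br (compose (punctured flags) f wt) (compose (punctured flags) g wt)
        = compose (punctured flags) (P f g) wt"
    unfolding weight_map_poisson_def by blast
  define \<epsilon> where "\<epsilon> = inv_into (inc v) (lab v)"
  \<comment> \<open>The bracket of the weights of the edges labelled \<open>i\<close> and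
    \<open>j\<close> at \<open>v\<close>, taken where all weights are 1.\<close>
  define \<alpha> where "\<alpha> i j = P (coord (arcs G) (\<epsilon> i)) (coord (arcs G) (\<epsilon> j)) (\<lambda>e\<in>arcs G. 1)" for i j
  have B: "poisson_bracket {1, 2, 3} (br v)"
    using br v by (auto simp: vertex_brackets_def)
  have "quadratic_relations \<alpha> (br v)"
    unfolding quadratic_relations_def
  proof (intro ballI impI ext)
    fix i j y assume ij: "i \<in> {1, 2, 3}" "j \<in> {1, 2, 3}" "i \<noteq> (j :: nat)"
    let ?B = "br v (coord {1, 2, 3} i) (coord {1, 2, 3} j)"
    have img: "lab v ` inc v = {1, 2, 3}" using lab_bij[OF v] by (simp add: bij_betw_def)
    have \<epsilon>: "\<epsilon> k \<in> inc v" "lab v (\<epsilon> k) = k" if "k \<in> {1, 2, 3}" for k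
      using that unfolding \<epsilon>_def img[symmetric] by (auto intro: inv_into_into f_inv_into_f)
    show "?B y = (\<lambda>x\<in>punctured {1, 2, 3}. \<alpha> i j * x i * x j) y"
    proof (cases "y \<in> punctured {1, 2, 3}")
      case True
      let ?x = "balanced_point v y"
      note x = balanced_point_punctured[OF v True]
      have ne: "\<epsilon> i \<noteq> \<epsilon> j" using \<epsilon>(2)[OF ij(1)] \<epsilon>(2)[OF ij(2)] ij(3) by auto
      have "\<alpha> i j = opp_coord ?x v (\<epsilon> i) * opp_coord ?x v (\<epsilon> j) * ?B y"
        using fun_cong[OF P[OF coord_smooth_functions coord_smooth_functions, of "\<epsilon> i" "\<epsilon> j"], of ?x]
          sum_bracket_coord[OF br x v \<epsilon>(1)[OF ij(1)] \<epsilon>(1)[OF ij(2)] ne] x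
        by (simp only: compose_def weight_map_balanced_point[OF v True] \<alpha>_def \<epsilon>(2) ij
            vertex_part_balanced_point[OF v True] restrict_apply if_True)
      \<comment> \<open>The opposite coordinates of a balanced point are the inverses of
        \<open>y i\<close> and \<open>y j\<close>.\<close>
      then have "\<alpha> i j = ?B y / (y i * y j)"
        by (simp add: balanced_point_opp[OF v True \<epsilon>(1)[OF ij(1)]] \<epsilon>(2)[OF ij(1)]
            balanced_point_opp[OF v True \<epsilon>(1)[OF ij(2)]] \<epsilon>(2)[OF ij(2)])
      then show ?thesis
        using True punctured_nonzero[OF True ij(1)] punctured_nonzero[OF True ij(2)] by simp
    next
      case False
      have "?B \<in> smooth_functions {1, 2, 3}"
        by (rule PiE_mem[OF PiE_mem[OF poisson_bracket_funcset[OF B]]]; rule coord_smooth_functions)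
      with False show ?thesis by (simp add: smooth_functions_iff extensional_def)
    qed
  qed
  then show ?thesis by blast
qed

section \<open>Vertex colours and the family of universal brackets\<close>

lemma white_inner: "white G n b v \<Longrightarrow> v \<in> inner_verts"
  by (simp add: white_def)

lemma black_inner: "black G n b v \<Longrightarrow> v \<in> inner_verts"
  by (simp add: black_def)

text \<open>In-degree and out-degree add up to 3, so they cannot both be 1.\<close>

lemma black_iff: "v \<in> inner_verts \<Longrightarrow> black G n b v \<longleftrightarrow> \<not> white G n b v"
proof -
  assume "v \<in> inner_verts"
  then have "in_degree G v + out_degree G v = 3" "white G n b v \<or> black G n b v"
    using network by (simp_all add: disk_network_def)
  then show ?thesis by (auto simp: white_def black_def)
qed

definition coeffs_at :: "(nat \<Rightarrow> nat \<Rightarrow> real) \<Rightarrow> (nat \<Rightarrow> nat \<Rightarrow> real) \<Rightarrow> 'v \<Rightarrow> nat \<Rightarrow> nat \<Rightarrow> real" where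
  "coeffs_at \<alpha> \<beta> v = (if white G n b v then \<alpha> else \<beta>)"

definition network_bracket ::
  "(nat \<Rightarrow> nat \<Rightarrow> real) \<Rightarrow> (nat \<Rightarrow> nat \<Rightarrow> real) \<Rightarrow> 'v \<Rightarrow> nat bracket" where
  "network_bracket \<alpha> \<beta> = (\<lambda>v\<in>inner_verts. log_bracket {1, 2, 3} (offdiag (coeffs_at \<alpha> \<beta> v)))"

lemma network_relations_iff:
  "network_relations G n b \<alpha> \<beta> br \<longleftrightarrow> (\<forall>v\<in>inner_verts. quadratic_relations (coeffs_at \<alpha> \<beta> v) (br v))"
proof -
  have "black G n b v \<longleftrightarrow> v \<in> inner_verts \<and> \<not> white G n b v" for v
    using black_iff black_inner by blast
  then show ?thesis
    using white_inner by (auto simp: network_relations_def coeffs_at_def split: if_splits)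
qed

lemma network_bracket_relations: "network_relations G n b \<alpha> \<beta> (network_bracket \<alpha> \<beta>)"
  by (simp add: network_relations_iff network_bracket_def quadratic_relations_log_bracket
      del: One_nat_def)

lemma network_bracket_vertex_brackets:
  "antisymmetric_coeffs \<alpha> \<Longrightarrow> antisymmetric_coeffs \<beta> \<Longrightarrow> network_bracket \<alpha> \<beta> \<in> vertex_brackets G n b"
  by (auto simp: vertex_brackets_def network_bracket_def coeffs_at_def poisson_bracket_offdiag
      simp del: One_nat_def)

text \<open>At an inner vertex the quadratic relations determine the bracket; at any other vertex
  both families are \<open>undefined\<close>.\<close>

lemma network_relations_imp_eq:
  assumes "br \<in> vertex_brackets G n b" "network_relations G n b \<alpha> \<beta> br"
  shows "br = network_bracket \<alpha> \<beta>"
proof (rule PiE_ext[of _ inner_verts])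
  show "br \<in> inner_verts \<rightarrow>\<^sub>E UNIV" "network_bracket \<alpha> \<beta> \<in> inner_verts \<rightarrow>\<^sub>E UNIV"
    using assms by (auto simp: vertex_brackets_def network_bracket_def PiE_iff)
  show "br v = network_bracket \<alpha> \<beta> v" if "v \<in> inner_verts" for v
    using that assms quadratic_relations_imp_log_bracket[of "br v" "coeffs_at \<alpha> \<beta> v"]
    by (auto simp: network_relations_iff vertex_brackets_def network_bracket_def)
qed

lemma network_bracket_universal: "universal G n b (network_bracket \<alpha> \<beta>)"
  unfolding universal_def network_bracket_def coeffs_at_def
  by (auto simp: white_inner black_inner dest: black_iff[THEN iffD1, rotated])

text \<open>One vertex of each colour supplies the coefficients, and universality carries them to
  all vertices of that colour.\<close>

lemma universal_imp_network_relations: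
  assumes br: "br \<in> vertex_brackets G n b" and u: "universal G n b br"
    and P: "weight_map_poisson G n b lab br"
  shows "\<exists>\<alpha> \<beta>. antisymmetric_coeffs \<alpha> \<and> antisymmetric_coeffs \<beta> \<and> network_relations G n b \<alpha> \<beta> br"
proof -
  have colour: "\<exists>\<alpha>. antisymmetric_coeffs \<alpha> \<and> (\<forall>v. C v \<longrightarrow> quadratic_relations \<alpha> (br v))"
    if C: "\<And>v. C v \<Longrightarrow> v \<in> inner_verts" and eq: "\<And>u v. C u \<Longrightarrow> C v \<Longrightarrow> br u = br v" for C
  proof (cases "\<exists>v. C v")
    case True
    then obtain v where v: "C v" by blast
    then obtain \<alpha> where \<alpha>: "quadratic_relations \<alpha> (br v)"
      using weight_map_poisson_imp_quadratic[OF br P C] by blast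
    have "poisson_bracket {1, 2, 3} (br v)"
      using br C[OF v] by (auto simp: vertex_brackets_def)
    then have "antisymmetric_coeffs \<alpha>" using \<alpha> by (rule quadratic_relations_antisymmetric)
    moreover have "quadratic_relations \<alpha> (br w)" if "C w" for w
      using \<alpha> eq[OF that v] by simp
    ultimately show ?thesis by blast
  next
    case False
    \<comment> \<open>If the colour does not occur, the relations hold vacuously and zero
      coefficients serve as a default.\<close>
    then show ?thesis by (intro exI[of _ "\<lambda>i j. 0"]) (auto simp: antisymmetric_coeffs_def)
  qed
  have "\<exists>\<alpha>. antisymmetric_coeffs \<alpha> \<and> (\<forall>v. white G n b v \<longrightarrow> quadratic_relations \<alpha> (br v))"
    using u unfolding universal_def by (intro colour[of "white G n b"] white_inner) blast+
  moreover have "\<exists>\<beta>. antisymmetric_coeffs \<beta> \<and> (\<forall>v. black G n b v \<longrightarrow> quadratic_relations \<beta> (br v))"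
    using u unfolding universal_def by (intro colour[of "black G n b"] black_inner) blast+
  ultimately show ?thesis by (auto simp: network_relations_def)
qed

section \<open>The pushed-forward bracket on edge weights\<close>

text \<open>At most one summand is nonzero: distinct edges share at most one vertex, and for
  \<open>e = e'\<close> each summand vanishes by \<open>offdiag\<close>.\<close>

definition edge_coeffs ::
  "(nat \<Rightarrow> nat \<Rightarrow> real) \<Rightarrow> (nat \<Rightarrow> nat \<Rightarrow> real) \<Rightarrow> 'e \<Rightarrow> 'e \<Rightarrow> real" where
  "edge_coeffs \<alpha> \<beta> e e' = (\<Sum>v\<in>inner_verts. if e \<in> inc v \<and> e' \<in> inc v
     then offdiag (coeffs_at \<alpha> \<beta> v) (lab v e) (lab v e') else 0)"

lemma network_bracket_weight_map_poisson:
  assumes \<alpha>: "antisymmetric_coeffs \<alpha>" and \<beta>: "antisymmetric_coeffs \<beta>"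
  shows "weight_map_poisson G n b lab (network_bracket \<alpha> \<beta>)"
  unfolding weight_map_poisson_def
proof (intro exI conjI ballI)
  let ?c = "\<lambda>v. offdiag (coeffs_at \<alpha> \<beta> v)"
  have lab: "lab v e \<in> {1, 2, 3}" if "v \<in> inner_verts" "e \<in> inc v" for v e
    using lab_bij[OF that(1)] that(2) by (auto simp: bij_betw_def)
  show "poisson_bracket (arcs G) (log_bracket (arcs G) (edge_coeffs \<alpha> \<beta>))"
  proof (rule poisson_bracket_log_bracket)
    fix e e'
    have "?c v (lab v e) (lab v e') = - ?c v (lab v e') (lab v e)"
      if "v \<in> inner_verts" "e \<in> inc v" "e' \<in> inc v" for v
      using that \<alpha> \<beta> by (intro offdiag_antisym lab) (auto simp: coeffs_at_def)
    then show "edge_coeffs \<alpha> \<beta> e e' = - edge_coeffs \<alpha> \<beta> e' e"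
      unfolding edge_coeffs_def sum_negf[symmetric] by (intro sum.cong refl) auto
  qed
  fix f g assume f: "f \<in> smooth_functions (arcs G)" and g: "g \<in> smooth_functions (arcs G)"
  show "sum_bracket G n b (network_bracket \<alpha> \<beta>) (compose (punctured flags) f wt)
      (compose (punctured flags) g wt)
    = compose (punctured flags) (log_bracket (arcs G) (edge_coeffs \<alpha> \<beta>) f g) wt"
  proof
    fix x
    show "sum_bracket G n b (network_bracket \<alpha> \<beta>) (compose (punctured flags) f wt)
      (compose (punctured flags) g wt) x
      = compose (punctured flags) (log_bracket (arcs G) (edge_coeffs \<alpha> \<beta>) f g) wt x"
    proof (cases "x \<in> punctured flags")
      case x: True
      let ?f = "\<lambda>e. log_deriv e f (wt x)" and ?g = "\<lambda>e. log_deriv e g (wt x)"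
      \<comment> \<open>The coordinate at \<open>v\<close> times the opposite one is the edge
        weight, so each partial derivative becomes a logarithmic derivative at
        \<open>wt x\<close>.\<close>
      have term_eq: "(opp_coord x v e * partial_deriv e f (wt x))
            * (opp_coord x v e' * partial_deriv e' g (wt x))
            * network_bracket \<alpha> \<beta> v (coord {1, 2, 3} (lab v e)) (coord {1, 2, 3} (lab v e'))
                (vertex_part v x)
          = ?c v (lab v e) (lab v e') * ?f e * ?g e'"
        if v: "v \<in> inner_verts" and e: "e \<in> inc v" "e' \<in> inc v" for v e e'
      proof -
        have "network_bracket \<alpha> \<beta> v (coord {1, 2, 3} (lab v e)) (coord {1, 2, 3} (lab v e'))
              (vertex_part v x)
            = ?c v (lab v e) (lab v e') * x (v, lab v e) * x (v, lab v e')"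
          using v log_bracket_coord[OF _ lab[OF v e(1)] lab[OF v e(2)], of "?c v"]
            vertex_part_punctured[OF x v] lab[OF v e(1)] lab[OF v e(2)]
          by (simp add: network_bracket_def) (simp add: vertex_part_def)
        then show ?thesis
          by (simp add: log_deriv_def weight_map_inc[OF e(1)] weight_map_inc[OF e(2)])
      qed
      \<comment> \<open>The sum over all pairs of edges is reorganised as a sum over inner vertices
        and pairs of edges at each of them.\<close>
      have "compose (punctured flags) (log_bracket (arcs G) (edge_coeffs \<alpha> \<beta>) f g) wt x
          = (\<Sum>e\<in>arcs G. \<Sum>e'\<in>arcs G. \<Sum>v\<in>inner_verts. if e \<in> inc v \<and> e' \<in> inc v
              then ?c v (lab v e) (lab v e') * ?f e * ?g e' else 0)"
        using x by (simp add: compose_def log_bracket_apply[OF f g weight_map_punctured[OF x]]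
            edge_coeffs_def sum_distrib_right if_distrib[of "\<lambda>t. t * _"] cong: if_cong)
      also have "\<dots> = (\<Sum>e\<in>arcs G. \<Sum>v\<in>inner_verts. \<Sum>e'\<in>arcs G. if e \<in> inc v \<and> e' \<in> inc v
              then ?c v (lab v e) (lab v e') * ?f e * ?g e' else 0)"
        by (rule sum.cong[OF refl]) (rule sum.swap)
      also have "\<dots> = (\<Sum>v\<in>inner_verts. \<Sum>e\<in>arcs G. \<Sum>e'\<in>arcs G. if e \<in> inc v \<and> e' \<in> inc v
              then ?c v (lab v e) (lab v e') * ?f e * ?g e' else 0)"
        by (rule sum.swap)
      also have "\<dots> = (\<Sum>v\<in>inner_verts. \<Sum>e\<in>inc v. \<Sum>e'\<in>inc v. ?c v (lab v e) (lab v e') * ?f e * ?g e')"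
      proof (rule sum.cong[OF refl])
        fix v
        have sub: "inc v \<subseteq> arcs G" by (auto simp: inc_iff)
        show "(\<Sum>e\<in>arcs G. \<Sum>e'\<in>arcs G. if e \<in> inc v \<and> e' \<in> inc v
              then ?c v (lab v e) (lab v e') * ?f e * ?g e' else 0)
            = (\<Sum>e\<in>inc v. \<Sum>e'\<in>inc v. ?c v (lab v e) (lab v e') * ?f e * ?g e')"
          by (intro sum.mono_neutral_cong_right sub finite_arcs) auto
      qed
      also have "\<dots> = sum_bracket G n b (network_bracket \<alpha> \<beta>) (compose (punctured flags) f wt)
          (compose (punctured flags) g wt) x"
        unfolding sum_bracket_expansion[OF network_bracket_vertex_brackets[OF \<alpha> \<beta>] x f g]
        by (intro sum.cong refl term_eq[symmetric])
      finally show ?thesis by simp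
    qed (simp add: sum_bracket_def compose_def)
  qed
qed

lemma admissible_brackets_eq:
  "{br \<in> vertex_brackets G n b. universal G n b br \<and> weight_map_poisson G n b lab br}
    = {br \<in> vertex_brackets G n b. \<exists>\<alpha> \<beta>. antisymmetric_coeffs \<alpha> \<and> antisymmetric_coeffs \<beta> \<and>
         network_relations G n b \<alpha> \<beta> br}" (is "?L = ?R")
proof (intro equalityI subsetI)
  fix br assume "br \<in> ?L"
  then show "br \<in> ?R" using universal_imp_network_relations by blast
next
  fix br assume br: "br \<in> ?R"
  then obtain \<alpha> \<beta> where \<alpha>\<beta>: "antisymmetric_coeffs \<alpha>" "antisymmetric_coeffs \<beta>"
    "network_relations G n b \<alpha> \<beta> br" by blast
  have "br = network_bracket \<alpha> \<beta>"
    using br \<alpha>\<beta>(3) by (blast intro: network_relations_imp_eq)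
  with br show "br \<in> ?L"
    using network_bracket_universal network_bracket_weight_map_poisson[OF \<alpha>\<beta>(1,2)] by simp
qed

lemma network_relations_unique:
  assumes "network_relations G n b \<alpha> \<beta> br" "network_relations G n b \<alpha>' \<beta>' br"
    and "i \<in> {1, 2, 3}" "j \<in> {1, 2, 3}" "i \<noteq> j"
  shows "\<exists>v. white G n b v \<Longrightarrow> \<alpha> i j = \<alpha>' i j" "\<exists>v. black G n b v \<Longrightarrow> \<beta> i j = \<beta>' i j"
  using assms quadratic_relations_unique[OF _ _ assms(3-5)] unfolding network_relations_def by blast+

end

section \<open>Parametrisation by six real numbers\<close>

lemma exhaust_6: fixes k :: 6 shows "k = 1 \<or> k = 2 \<or> k = 3 \<or> k = 4 \<or> k = 5 \<or> k = 6"
proof (induct k)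
  case (of_int z)
  then have "0 \<le> z" and "z < 6" by simp_all
  \<comment> \<open>The case \<open>z = 0\<close> is the index \<open>6\<close>, as numerals of this
    type are taken modulo 6.\<close>
  then have "z = 0 \<or> z = 1 \<or> z = 2 \<or> z = 3 \<or> z = 4 \<or> z = 5" by arith
  then show ?case by auto
qed

lemma vector_6:
  "(vector [a1, a2, a3, a4, a5, a6] :: real ^ 6) $ 1 = a1"
  "(vector [a1, a2, a3, a4, a5, a6] :: real ^ 6) $ 2 = a2"
  "(vector [a1, a2, a3, a4, a5, a6] :: real ^ 6) $ 3 = a3"
  "(vector [a1, a2, a3, a4, a5, a6] :: real ^ 6) $ 4 = a4"
  "(vector [a1, a2, a3, a4, a5, a6] :: real ^ 6) $ 5 = a5"
  "(vector [a1, a2, a3, a4, a5, a6] :: real ^ 6) $ 6 = a6"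
  unfolding vector_def by simp_all

lemma antisymmetric_skew_coeffs: "antisymmetric_coeffs (skew_coeffs s t u)"
  by (auto simp: antisymmetric_coeffs_def skew_coeffs_def)

lemma skew_coeffs_apply:
  "skew_coeffs s t u 1 2 = s" "skew_coeffs s t u 1 3 = t" "skew_coeffs s t u 2 3 = u"
  by (simp_all add: skew_coeffs_def)

text \<open>The relations read entries off the diagonal, and antisymmetry recovers all of these from
  the three above it.\<close>

lemma quadratic_relations_skew_coeffs:
  assumes "antisymmetric_coeffs \<alpha>"
  shows "quadratic_relations (skew_coeffs (\<alpha> 1 2) (\<alpha> 1 3) (\<alpha> 2 3)) B \<longleftrightarrow> quadratic_relations \<alpha> B"
proof -
  note anti = assms[unfolded antisymmetric_coeffs_def, rule_format]
  have "\<alpha> 2 1 = - \<alpha> 1 2" "\<alpha> 3 1 = - \<alpha> 1 3" "\<alpha> 3 2 = - \<alpha> 2 3"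
    using anti[of 2 1] anti[of 3 1] anti[of 3 2] by simp_all
  then have "skew_coeffs (\<alpha> 1 2) (\<alpha> 1 3) (\<alpha> 2 3) i j = \<alpha> i j"
    if "i \<in> {1, 2, 3}" "j \<in> {1, 2, 3}" "i \<noteq> j" for i j
    using that by (auto simp: skew_coeffs_def)
  then show ?thesis by (simp add: quadratic_relations_def)
qed

context labelled_network
begin

definition param_bracket :: "real ^ 6 \<Rightarrow> 'v \<Rightarrow> nat bracket" where
  "param_bracket p = network_bracket (skew_coeffs (p $ 1) (p $ 2) (p $ 3))
     (skew_coeffs (p $ 4) (p $ 5) (p $ 6))"

text \<open>A vertex of each colour allows both arrays to be read off, which gives injectivity. For
  surjectivity, \<open>admissible_brackets_eq\<close> provides two antisymmetric arrays, and the
  entries above their diagonals are the six parameters.\<close>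

lemma bij_param_bracket:
  assumes "\<exists>v. white G n b v" "\<exists>v. black G n b v"
  shows "bij_betw param_bracket UNIV
    {br \<in> vertex_brackets G n b. universal G n b br \<and> weight_map_poisson G n b lab br}"
  unfolding bij_betw_def
proof (intro conjI equalityI subsetI)
  show "inj param_bracket"
  proof (rule injI)
    fix p q assume eq: "param_bracket p = param_bracket q"
    have r: "network_relations G n b (skew_coeffs (p $ 1) (p $ 2) (p $ 3))
        (skew_coeffs (p $ 4) (p $ 5) (p $ 6)) (param_bracket p)" for p
      unfolding param_bracket_def by (rule network_bracket_relations)
    note u = network_relations_unique[OF r[of p] r[of q, folded eq]]
    have "p $ 1 = q $ 1" "p $ 2 = q $ 2" "p $ 3 = q $ 3" "p $ 4 = q $ 4" "p $ 5 = q $ 5" "p $ 6 = q $ 6"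
      using u(1)[OF _ _ _ assms(1), of 1 2] u(1)[OF _ _ _ assms(1), of 1 3]
        u(1)[OF _ _ _ assms(1), of 2 3] u(2)[OF _ _ _ assms(2), of 1 2]
        u(2)[OF _ _ _ assms(2), of 1 3] u(2)[OF _ _ _ assms(2), of 2 3]
      unfolding skew_coeffs_apply by auto
    then have "p $ k = q $ k" for k using exhaust_6[of k] by (elim disjE) simp_all
    then show "p = q" by (simp add: vec_eq_iff)
  qed
next
  fix br assume "br \<in> range param_bracket"
  then show "br \<in> {br \<in> vertex_brackets G n b. universal G n b br \<and> weight_map_poisson G n b lab br}"
    by (auto simp: param_bracket_def antisymmetric_skew_coeffs network_bracket_universal
        network_bracket_vertex_brackets network_bracket_weight_map_poisson)
next
  fix br assume "br \<in> {br \<in> vertex_brackets G n b. universal G n b br \<and> weight_map_poisson G n b lab br}"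
  then obtain \<alpha> \<beta> where br: "br \<in> vertex_brackets G n b" "antisymmetric_coeffs \<alpha>"
      "antisymmetric_coeffs \<beta>" "network_relations G n b \<alpha> \<beta> br"
    unfolding admissible_brackets_eq by blast
  let ?p = "vector [\<alpha> 1 2, \<alpha> 1 3, \<alpha> 2 3, \<beta> 1 2, \<beta> 1 3, \<beta> 2 3] :: real ^ 6"
  have "network_relations G n b (skew_coeffs (\<alpha> 1 2) (\<alpha> 1 3) (\<alpha> 2 3))
      (skew_coeffs (\<beta> 1 2) (\<beta> 1 3) (\<beta> 2 3)) br"
    using br(4) unfolding network_relations_def
      quadratic_relations_skew_coeffs[OF br(2)] quadratic_relations_skew_coeffs[OF br(3)] .
  from network_relations_imp_eq[OF br(1) this] have "br = param_bracket ?p"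
    by (simp only: param_bracket_def vector_6)
  then show "br \<in> range param_bracket" by blast
qed

end

theorem proposition3p1:
  fixes G :: "('v, 'e) pre_digraph" and n :: nat and b :: "nat \<Rightarrow> 'v" and lab :: "'v \<Rightarrow> 'e \<Rightarrow> nat"
  assumes "disk_network G n b" and "flag_labelling G n b lab"
  shows "({br \<in> vertex_brackets G n b. universal G n b br \<and> weight_map_poisson G n b lab br}
           = {br \<in> vertex_brackets G n b. \<exists>\<alpha> \<beta>. antisymmetric_coeffs \<alpha> \<and> antisymmetric_coeffs \<beta> \<and>
                network_relations G n b \<alpha> \<beta> br}) \<and>
         (\<forall>\<alpha> \<beta>. antisymmetric_coeffs \<alpha> \<and> antisymmetric_coeffs \<beta> \<longrightarrow>
           (\<exists>!br. br \<in> vertex_brackets G n b \<and> network_relations G n b \<alpha> \<beta> br)) \<and>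
         (\<forall>\<alpha> \<beta> \<alpha>' \<beta>' br. br \<in> vertex_brackets G n b \<and>
           network_relations G n b \<alpha> \<beta> br \<and> network_relations G n b \<alpha>' \<beta>' br \<longrightarrow>
           ((\<exists>v. white G n b v) \<longrightarrow> (\<forall>i\<in>{1, 2, 3}. \<forall>j\<in>{1, 2, 3}. i \<noteq> j \<longrightarrow> \<alpha> i j = \<alpha>' i j)) \<and>
           ((\<exists>v. black G n b v) \<longrightarrow> (\<forall>i\<in>{1, 2, 3}. \<forall>j\<in>{1, 2, 3}. i \<noteq> j \<longrightarrow> \<beta> i j = \<beta>' i j))) \<and>
         ((\<exists>v. white G n b v) \<and> (\<exists>v. black G n b v) \<longrightarrow>
           (\<exists>\<Phi> :: real ^ 6 \<Rightarrow> 'v \<Rightarrow> nat bracket.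
              bij_betw \<Phi> UNIV
                {br \<in> vertex_brackets G n b. universal G n b br \<and> weight_map_poisson G n b lab br} \<and>
              (\<forall>p. network_relations G n b (skew_coeffs (p $ 1) (p $ 2) (p $ 3))
                                             (skew_coeffs (p $ 4) (p $ 5) (p $ 6)) (\<Phi> p))))"
proof -
  interpret labelled_network G n b lab
    using assms by unfold_locales
  show ?thesis
  proof (intro conjI allI impI ballI)
    show "{br \<in> vertex_brackets G n b. universal G n b br \<and> weight_map_poisson G n b lab br}
           = {br \<in> vertex_brackets G n b. \<exists>\<alpha> \<beta>. antisymmetric_coeffs \<alpha> \<and> antisymmetric_coeffs \<beta> \<and>
                network_relations G n b \<alpha> \<beta> br}"
      by (rule admissible_brackets_eq)
  next
    fix \<alpha> \<beta> assume "antisymmetric_coeffs \<alpha> \<and> antisymmetric_coeffs \<beta>"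
    then show "\<exists>!br. br \<in> vertex_brackets G n b \<and> network_relations G n b \<alpha> \<beta> br"
      using network_bracket_vertex_brackets network_bracket_relations network_relations_imp_eq
      by (intro ex1I[of _ "network_bracket \<alpha> \<beta>"]) auto
  next
    assume "(\<exists>v. white G n b v) \<and> (\<exists>v. black G n b v)"
    \<comment> \<open>The witness is \<open>param_bracket\<close>.\<close>
    then show "\<exists>\<Phi> :: real ^ 6 \<Rightarrow> 'v \<Rightarrow> nat bracket.
        bij_betw \<Phi> UNIV
          {br \<in> vertex_brackets G n b. universal G n b br \<and> weight_map_poisson G n b lab br} \<and>
        (\<forall>p. network_relations G n b (skew_coeffs (p $ 1) (p $ 2) (p $ 3))
                                       (skew_coeffs (p $ 4) (p $ 5) (p $ 6)) (\<Phi> p))"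
      using bij_param_bracket network_bracket_relations unfolding param_bracket_def[abs_def] by blast
  next
    fix \<alpha> \<beta> \<alpha>' \<beta>' br and i j :: nat
    assume r: "br \<in> vertex_brackets G n b \<and>
        network_relations G n b \<alpha> \<beta> br \<and> network_relations G n b \<alpha>' \<beta>' br"
      and ij: "i \<in> {1, 2, 3}" "j \<in> {1, 2, 3}" "i \<noteq> j"
    note u = network_relations_unique[OF conjunct1[OF conjunct2[OF r]] conjunct2[OF conjunct2[OF r]] ij]
    show "\<exists>v. white G n b v \<Longrightarrow> \<alpha> i j = \<alpha>' i j" by (rule u(1))
    show "\<exists>v. black G n b v \<Longrightarrow> \<beta> i j = \<beta>' i j" by (rule u(2))
  qed
qed

end
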